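(* Let $S$ be a self-adjoint subspace in $X^2$ and $A$ a closed Hermitian subspace in $X^2$ with $D(S)\subset D(A)$. If $A_s$ is $S_s$-compact, then $\sigma_e(S)=\sigma_e(S+A)$; consequently $\sigma_e(S)=\emptyset$ if and only if $\sigma_e(S+A)=\emptyset$.
   Context: $X$ is a complex Hilbert space and $X^2=X\times X$ carries the inner product $\langle (x,f),(y,g)\rangle=\langle x,y\rangle+\langle f,g\rangle$. A subspace $T$ in $X^2$ means a linear subspace of $X^2$ (a linear relation); a linear operator in $X$ is identified with its graph. Notation: $D(T)=\{x:(x,f)\in T \text{ for some } f\}$, $T(x)=\{f:(x,f)\in T\}$, $T^{-1}=\{(f,x):(x,f)\in T\}$, $\lambda I$ is the graph of $x\mapsto\lambda x$. The adjoint is $T^*=\{(y,g)\in X^2:\langle g,x\rangle=\langle y,f\rangle \text{ for all }(x,f)\in T\}$; $T$ is Hermitian if $T\subset T^*$ and self-adjoint if $T=T^*$. For subspaces $S,A$ in $X^2$, $S+A=\{(x,f+g):(x,f)\in S,(x,g)\in A\}$. For a closed subspace $T$, set $T_\infty=\{(0,g)\in X^2:(0,g)\in T\}$ and $T_s=T\ominus T_\infty$ (orthogonal complement of $T_\infty$ in $T$), so $T=T_s\oplus T_\infty$; $T_s$ is the graph of a linear operator (the operator part of $T$) with $D(T_s)=D(T)$ and $R(T_s)\subset T(0)^\perp$. For linear operators $U,V$ in $X$ with $D(V)\subset D(U)$: $U$ is $V$-compact if $U|_{D(V)}$ is compact as a map from $(D(V),\|\cdot\|_V)$ into $X$, where $\|x\|_V=\|x\|+\|Vx\|$.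 Resolvent set: $\rho(T)=\{\lambda\in\mathbb C:(\lambda I-T)^{-1}$ is a bounded linear operator defined on all of $X\}$; spectrum $\sigma(T)=\mathbb C\setminus\rho(T)$. A number $\lambda$ is an eigenvalue of $T$ if $(x,\lambda x)\in T$ for some $x\ne 0$, with multiplicity the dimension of $\{x:(x,\lambda x)\in T\}$. The essential spectrum $\sigma_e(T)$ is the set of points of $\sigma(T)$ that are either accumulation points of $\sigma(T)$ or isolated eigenvalues of infinite multiplicity. *)

theory Defs
  imports "HOL-Analysis.Analysis"
begin

text \<open>HOL-Analysis only provides real inner product spaces, so we introduce complex
Hilbert spaces as a type class: a real Banach space with a complex scalar multiplication
extending the real one and a complex inner product inducing the norm.\<close>

class chilbert = banach +
  fixes scaleC :: "complex \<Rightarrow> 'a \<Rightarrow> 'a"  (infixr "*\<^sub>C" 75)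
    and cinner :: "'a \<Rightarrow> 'a \<Rightarrow> complex"
  assumes scaleC_add_right: "a *\<^sub>C (x + y) = a *\<^sub>C x + a *\<^sub>C y"
    and scaleC_add_left: "(a + b) *\<^sub>C x = a *\<^sub>C x + b *\<^sub>C x"
    and scaleC_scaleC: "a *\<^sub>C (b *\<^sub>C x) = (a * b) *\<^sub>C x"
    and scaleC_one: "1 *\<^sub>C x = x"
    and scaleR_scaleC: "scaleR r x = complex_of_real r *\<^sub>C x"
    and cinner_add_left: "cinner (x + y) z = cinner x z + cinner y z"
    and cinner_scaleC_left: "cinner (a *\<^sub>C x) y = a * cinner x y"
    and cinner_commute: "cinner y x = cnj (cinner x y)"
    and norm_cinner: "complex_of_real ((norm x)\<^sup>2) = cinner x x"

type_synonym 'a rel2 = "('a \<times> 'a) set"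

definition lin_rel :: "'a::chilbert rel2 \<Rightarrow> bool" where
  "lin_rel T \<longleftrightarrow> (0, 0) \<in> T
     \<and> (\<forall>x f y g. (x, f) \<in> T \<longrightarrow> (y, g) \<in> T \<longrightarrow> (x + y, f + g) \<in> T)
     \<and> (\<forall>c x f. (x, f) \<in> T \<longrightarrow> (c *\<^sub>C x, c *\<^sub>C f) \<in> T)"

definition rdom :: "'a rel2 \<Rightarrow> 'a set" where
  "rdom T = {x. \<exists>f. (x, f) \<in> T}"

definition radjoint :: "'a::chilbert rel2 \<Rightarrow> 'a rel2" where
  "radjoint T = {(y, g). \<forall>x f. (x, f) \<in> T \<longrightarrow> cinner g x = cinner y f}"

definition hermitian :: "'a::chilbert rel2 \<Rightarrow> bool" where
  "hermitian T \<longleftrightarrow> T \<subseteq> radjoint T"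

definition selfadjoint :: "'a::chilbert rel2 \<Rightarrow> bool" where
  "selfadjoint T \<longleftrightarrow> T = radjoint T"

definition relation_sum :: "'a::chilbert rel2 \<Rightarrow> 'a rel2 \<Rightarrow> 'a rel2" where
  "relation_sum S A = {(x, f + g) | x f g. (x, f) \<in> S \<and> (x, g) \<in> A}"

definition pinner :: "'a::chilbert \<times> 'a \<Rightarrow> 'a \<times> 'a \<Rightarrow> complex" where
  "pinner p q = cinner (fst p) (fst q) + cinner (snd p) (snd q)"

definition rel_inf :: "'a::chilbert rel2 \<Rightarrow> 'a rel2" where
  "rel_inf T = {(0, g) | g. (0, g) \<in> T}"

definition op_part :: "'a::chilbert rel2 \<Rightarrow> 'a rel2" where
  "op_part T = {p \<in> T. \<forall>q \<in> rel_inf T. pinner p q = 0}"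

text \<open>U is V-compact (U, V graphs of operators, D(V) subset D(U)): U restricted to D(V)
maps sets bounded w.r.t. the graph norm of V to relatively compact sets.\<close>
definition rel_compact :: "'a::chilbert rel2 \<Rightarrow> 'a rel2 \<Rightarrow> bool" where
  "rel_compact U V \<longleftrightarrow> (\<forall>B M. B \<subseteq> V \<longrightarrow> (\<forall>(x, f) \<in> B. norm x + norm f \<le> M) \<longrightarrow>
       compact (closure {g. \<exists>x f. (x, f) \<in> B \<and> (x, g) \<in> U}))"

definition resolvent_rel :: "complex \<Rightarrow> 'a::chilbert rel2 \<Rightarrow> 'a rel2" where
  "resolvent_rel l T = {(l *\<^sub>C x - f, x) | x f. (x, f) \<in> T}"

definition bounded_everywhere_op :: "'a::chilbert rel2 \<Rightarrow> bool" where
  "bounded_everywhere_op R \<longleftrightarrow> lin_rel R \<and> (\<forall>y. \<exists>!x. (y, x) \<in> R)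
      \<and> (\<exists>C. \<forall>y x. (y, x) \<in> R \<longrightarrow> norm x \<le> C * norm y)"

definition rel_resolvent_set :: "'a::chilbert rel2 \<Rightarrow> complex set" where
  "rel_resolvent_set T = {l. bounded_everywhere_op (resolvent_rel l T)}"

definition rel_spectrum :: "'a::chilbert rel2 \<Rightarrow> complex set" where
  "rel_spectrum T = UNIV - rel_resolvent_set T"

definition eigenspace :: "'a::chilbert rel2 \<Rightarrow> complex \<Rightarrow> 'a set" where
  "eigenspace T l = {x. (x, l *\<^sub>C x) \<in> T}"

definition cindependent :: "'a::chilbert set \<Rightarrow> bool" where
  "cindependent F \<longleftrightarrow> (\<forall>c. (\<Sum>x\<in>F. c x *\<^sub>C x) = 0 \<longrightarrow> (\<forall>x\<in>F. c x = 0))"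

definition infinite_dim :: "'a::chilbert set \<Rightarrow> bool" where
  "infinite_dim E \<longleftrightarrow> (\<forall>n. \<exists>F. F \<subseteq> E \<and> finite F \<and> card F = n \<and> cindependent F)"

definition is_eigenvalue :: "'a::chilbert rel2 \<Rightarrow> complex \<Rightarrow> bool" where
  "is_eigenvalue T l \<longleftrightarrow> (\<exists>x. x \<noteq> 0 \<and> (x, l *\<^sub>C x) \<in> T)"

definition ess_spectrum :: "'a::chilbert rel2 \<Rightarrow> complex set" where
  "ess_spectrum T = {l \<in> rel_spectrum T. l islimpt rel_spectrum T
      \<or> (\<not> l islimpt rel_spectrum T \<and> is_eigenvalue T l \<and> infinite_dim (eigenspace T l))}"

end

theory Submission
  imports Defs
begin

text \<open>
A point \<open>l\<close> is called semi-Fredholm for \<open>T\<close> if every bounded sequence \<open>x\<^sub>n\<close> in \<open>D(T)\<close> along which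
some \<open>f\<^sub>n - l x\<^sub>n\<close> with \<open>(x\<^sub>n, f\<^sub>n) \<in> T\<close> converges has a convergent subsequence. For self-adjoint \<open>T\<close> the
essential spectrum is exactly the set of points that are not semi-Fredholm. If \<open>l\<close> is
semi-Fredholm, \<open>T - l\<close> has a finite-dimensional kernel and is bounded below on its complement,
which keeps the spectrum away from a punctured neighbourhood of \<open>l\<close>. Conversely, if such a
neighbourhood of radius \<open>2t\<close> lies in the resolvent set, then the bound of the resolvent by the inverse
distance to the spectrum shows that the bounded symmetric operator \<open>C = (T - l)(T - l - t)\<^sup>-\<^sup>1\<close>
satisfies \<open>0 \<le> C \<le> (3/2) C\<^sup>2\<close>; hence \<open>C\<close> is bounded below on the closure of its range, and a
finite-dimensional kernel suffices for \<open>l\<close> to be semi-Fredholm.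

Since \<open>A(0) \<subseteq> S(0)\<close>, the sum \<open>S + A\<close> only depends on the operator part of \<open>A\<close>. Relative compactness
makes the relative bound arbitrarily small, so that \<open>S + A\<close> is self-adjoint (Kato-Rellich), and along the
sequences above the perturbation converges on a subsequence, so that \<open>S\<close> and \<open>S + A\<close> have the same
semi-Fredholm points.
\<close>

section \<open>Complex Hilbert spaces\<close>

interpretation cvs: vector_space "scaleC :: complex \<Rightarrow> 'a::chilbert \<Rightarrow> 'a"
  by unfold_locales (simp_all add: scaleC_add_right scaleC_add_left scaleC_scaleC scaleC_one)

lemma cinner_add_right: "cinner x (y + z) = cinner x y + cinner x z"
  by (metis cinner_add_left cinner_commute complex_cnj_add)

lemma cinner_scaleC_right: "cinner x (a *\<^sub>C y) = cnj a * cinner x y"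
  by (metis cinner_scaleC_left cinner_commute complex_cnj_mult)

lemma norm_sq_eq_cinner: "(norm x)\<^sup>2 = Re (cinner x x)"
  using norm_cinner[of x] by (metis Re_complex_of_real)

lemma Re_cinner_commute: "Re (cinner y x) = Re (cinner x y)"
  by (metis cinner_commute cnj.sel(1))

lemma norm_add_sq:
  fixes x y :: "'a::chilbert"
  shows "(norm (x + y))\<^sup>2 = (norm x)\<^sup>2 + 2 * Re (cinner x y) + (norm y)\<^sup>2"
  using Re_cinner_commute[of x y]
  by (simp add: norm_sq_eq_cinner cinner_add_left cinner_add_right)

lemma scaleC_minus_one: "(- 1) *\<^sub>C x = - (x::'a::chilbert)"
  by simp

lemma cinner_minus_left: "cinner (- x) y = - cinner x y"
  by (metis cinner_scaleC_left mult_minus1 scaleC_minus_one)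

lemma cinner_minus_right: "cinner x (- y) = - cinner x y"
  by (metis cinner_commute cinner_minus_left complex_cnj_minus)

lemma cinner_diff_left: "cinner (x - y) z = cinner x z - cinner y z"
  by (metis cinner_add_left cinner_minus_left diff_conv_add_uminus)

lemma cinner_diff_right: "cinner x (y - z) = cinner x y - cinner x z"
  by (metis cinner_add_right cinner_minus_right diff_conv_add_uminus)

lemma norm_diff_sq:
  fixes x y :: "'a::chilbert"
  shows "(norm (x - y))\<^sup>2 = (norm x)\<^sup>2 - 2 * Re (cinner x y) + (norm y)\<^sup>2"
  using norm_add_sq[of x "- y"] by (simp add: cinner_minus_right)

lemma norm_scaleC: "norm (a *\<^sub>C x) = cmod a * norm (x::'a::chilbert)"
proof -
  have "complex_of_real ((norm (a *\<^sub>C x))\<^sup>2) = (a * cnj a) * cinner x x"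
    by (simp only: norm_cinner cinner_scaleC_left cinner_scaleC_right mult_ac)
  also have "\<dots> = complex_of_real ((cmod a * norm x)\<^sup>2)"
    by (simp add: complex_norm_square[symmetric] norm_cinner[symmetric] power_mult_distrib)
  finally have "(norm (a *\<^sub>C x))\<^sup>2 = (cmod a * norm x)\<^sup>2"
    using of_real_eq_iff by blast
  then show ?thesis
    by (simp add: power2_eq_iff_nonneg)
qed

lemma cinner_zero_left [simp]: "cinner 0 x = 0"
  using cinner_diff_left[of 0 0 x] by simp

lemma cinner_zero_right [simp]: "cinner x 0 = 0"
  by (metis cinner_commute cinner_zero_left complex_cnj_zero)

lemma cinner_eq_zero_iff [simp]: "cinner x x = 0 \<longleftrightarrow> x = 0"
  by (metis norm_cinner of_real_eq_0_iff power_eq_0_iff norm_eq_zero cinner_zero_left)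

lemma Cauchy_Schwarz_cinner: "cmod (cinner x y) \<le> norm x * norm (y::'a::chilbert)"
proof (cases "y = 0")
  case False
  \<comment> \<open>\<open>c *\<^sub>C y\<close> is the orthogonal projection of \<open>x\<close>
    onto the line through \<open>y\<close>; the claim is that the squared distance to it is
    nonnegative.\<close>
  define c where "c = cinner x y / complex_of_real ((norm y)\<^sup>2)"
  have ny: "(norm y)\<^sup>2 > 0" using False by simp
  have "Re (cinner x (c *\<^sub>C y)) = Re (cnj (cinner x y) * cinner x y / complex_of_real ((norm y)\<^sup>2))"
    by (simp add: c_def cinner_scaleC_right)
  also have "\<dots> = (cmod (cinner x y))\<^sup>2 / (norm y)\<^sup>2"
    by (metis complex_norm_square mult.commute of_real_divide Re_complex_of_real)
  finally have 1: "Re (cinner x (c *\<^sub>C y)) = (cmod (cinner x y))\<^sup>2 / (norm y)\<^sup>2" .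
  have "cmod c = cmod (cinner x y) / (norm y)\<^sup>2"
    unfolding c_def norm_divide norm_of_real using ny by simp
  then have 2: "(norm (c *\<^sub>C y))\<^sup>2 = (cmod (cinner x y))\<^sup>2 / (norm y)\<^sup>2"
    using ny by (simp add: norm_scaleC power_mult_distrib power_divide power2_eq_square)
  have "0 \<le> (norm (x - c *\<^sub>C y))\<^sup>2" by simp
  then have "(cmod (cinner x y))\<^sup>2 / (norm y)\<^sup>2 \<le> (norm x)\<^sup>2"
    unfolding norm_diff_sq 1 2 by simp
  then have "(cmod (cinner x y))\<^sup>2 \<le> (norm x * norm y)\<^sup>2"
    using ny by (simp add: divide_le_eq power_mult_distrib)
  then show ?thesis by (rule power2_le_imp_le) simp
qed simp

lemma Re_cinner_le: "\<bar>Re (cinner x y)\<bar> \<le> norm x * norm (y::'a::chilbert)"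
  using Cauchy_Schwarz_cinner[of x y] abs_Re_le_cmod[of "cinner x y"] by linarith

interpretation cinner: bounded_bilinear "cinner :: 'a::chilbert \<Rightarrow> 'a \<Rightarrow> complex"
proof
  fix r :: real and a b :: 'a
  show "cinner (r *\<^sub>R a) b = r *\<^sub>R cinner a b" "cinner a (r *\<^sub>R b) = r *\<^sub>R cinner a b"
    by (simp_all add: scaleR_scaleC cinner_scaleC_left cinner_scaleC_right scaleR_conv_of_real)
  show "\<exists>K. \<forall>a b::'a. cmod (cinner a b) \<le> norm a * norm b * K"
    by (rule exI[of _ 1]) (simp add: Cauchy_Schwarz_cinner)
qed (simp_all add: cinner_add_left cinner_add_right)

interpretation scaleC: bounded_bilinear "scaleC :: complex \<Rightarrow> 'a::chilbert \<Rightarrow> 'a"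
proof
  fix r :: real and a :: complex and b :: 'a
  show "(r *\<^sub>R a) *\<^sub>C b = r *\<^sub>R (a *\<^sub>C b)" "a *\<^sub>C (r *\<^sub>R b) = r *\<^sub>R (a *\<^sub>C b)"
    by (simp_all add: scaleR_scaleC scaleR_conv_of_real mult.commute)
  show "\<exists>K. \<forall>a (b::'a). norm (a *\<^sub>C b) \<le> norm a * norm b * K"
    by (rule exI[of _ 1]) (simp add: norm_scaleC)
qed (simp_all add: scaleC_add_left scaleC_add_right)

section \<open>Orthogonal projection onto closed subspaces\<close>

text \<open>A minimising sequence for the distance from \<open>x\<close> to \<open>M\<close> is
  Cauchy by the parallelogram identity. Its limit attains the distance, and minimality along each
  direction \<open>q\<close> forces orthogonality.\<close>

lemma ex_orthogonal_projection:
  fixes M :: "'a::chilbert set"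
  assumes M: "cvs.subspace M" "closed M"
  obtains p where "p \<in> M" "\<And>q. q \<in> M \<Longrightarrow> cinner (x - p) q = 0"
proof -
  define d where "d = infdist x M"
  have ne: "M \<noteq> {}" using cvs.subspace_0[OF M(1)] by blast
  have d0: "0 \<le> d" unfolding d_def by (rule infdist_nonneg)
  have dle: "d \<le> norm (x - m)" if "m \<in> M" for m
    using infdist_le[OF that, of x] by (simp add: d_def dist_norm)
  have "\<exists>m\<in>M. norm (x - m) < d + inverse (real (Suc n))" for n
  proof -
    have "infdist x M < d + inverse (real (Suc n))" by (simp add: d_def)
    then have "Inf (dist x ` M) < d + inverse (real (Suc n))"
      using ne by (simp add: infdist_def)
    then show ?thesis
      using ne by (subst (asm) cInf_less_iff) (auto simp: dist_norm intro!: bdd_belowI[of _ 0])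
  qed
  then obtain m where m: "\<And>n. m n \<in> M" "\<And>n. norm (x - m n) < d + inverse (real (Suc n))"
    by metis
  have lim: "(\<lambda>n. norm (x - m n)) \<longlonglongrightarrow> d"
  proof (rule tendsto_sandwich[of "\<lambda>_. d" _ _ "\<lambda>n. d + inverse (real (Suc n))"])
    show "(\<lambda>n. d + inverse (real (Suc n))) \<longlonglongrightarrow> d"
      using tendsto_add[OF tendsto_const LIMSEQ_inverse_real_of_nat, of d] by simp
    show "\<forall>\<^sub>F n in sequentially. d \<le> norm (x - m n)" using m(1) dle by simp
    show "\<forall>\<^sub>F n in sequentially. norm (x - m n) \<le> d + inverse (real (Suc n))"
      using m(2) less_imp_le by (intro always_eventually allI) blast
  qed simp
  \<comment> \<open>Parallelogram identity for \<open>x - m i\<close> and \<open>x - m j\<close>: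
    half their sum is \<open>x\<close> minus the midpoint, which lies in \<open>M\<close>, so it has
    norm at least \<open>d\<close>.\<close>
  have par: "(norm (m i - m j))\<^sup>2 \<le> 2 * ((norm (x - m i))\<^sup>2 - d\<^sup>2) + 2 * ((norm (x - m j))\<^sup>2 - d\<^sup>2)" for i j
  proof -
    let ?a = "x - m i" and ?b = "x - m j"
    have mid: "(1/2) *\<^sub>C (m i + m j) \<in> M"
      by (intro cvs.subspace_scale cvs.subspace_add m M)
    have "?a + ?b = 2 *\<^sub>C (x - (1/2) *\<^sub>C (m i + m j))"
      by (simp add: scaleC.diff_right) (simp add: scaleC_add_left[of 1 1, simplified])
    then have "norm (?a + ?b) = 2 * norm (x - (1/2) *\<^sub>C (m i + m j))"
      by (simp add: norm_scaleC)
    then have "2 * d \<le> norm (?a + ?b)" using dle[OF mid] by simp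
    then have "4 * d\<^sup>2 \<le> (norm (?a + ?b))\<^sup>2"
      using power_mono[of "2 * d" _ 2] d0 by (simp add: power_mult_distrib)
    moreover have "(norm (?a + ?b))\<^sup>2 + (norm (?a - ?b))\<^sup>2 = 2 * (norm ?a)\<^sup>2 + 2 * (norm ?b)\<^sup>2"
      using norm_add_sq[of ?a ?b] norm_diff_sq[of ?a ?b] by linarith
    moreover have "norm (m i - m j) = norm (?a - ?b)" by (simp add: norm_minus_commute)
    ultimately show ?thesis by simp
  qed
  have "Cauchy m"
  proof (rule CauchyI)
    fix e :: real assume e: "0 < e"
    have "(\<lambda>n. (norm (x - m n))\<^sup>2 - d\<^sup>2) \<longlonglongrightarrow> 0"
      using tendsto_diff[OF tendsto_power[OF lim, of 2] tendsto_const, of "d\<^sup>2"] by simp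
    then have "\<forall>\<^sub>F n in sequentially. (norm (x - m n))\<^sup>2 - d\<^sup>2 < e\<^sup>2 / 4"
      using e by (intro order_tendstoD) auto
    then obtain N where N: "\<And>n. n \<ge> N \<Longrightarrow> (norm (x - m n))\<^sup>2 - d\<^sup>2 < e\<^sup>2 / 4"
      by (auto simp: eventually_sequentially)
    have "norm (m i - m j) < e" if "i \<ge> N" "j \<ge> N" for i j
    proof -
      have "(norm (m i - m j))\<^sup>2 < e\<^sup>2" using par[of i j] N[OF that(1)] N[OF that(2)] by argo
      then show ?thesis using e by (auto dest: power2_less_imp_less)
    qed
    then show "\<exists>N. \<forall>i\<ge>N. \<forall>j\<ge>N. norm (m i - m j) < e" by blast
  qed
  then obtain p where p: "m \<longlonglongrightarrow> p" using Cauchy_convergent convergentD by blast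
  have pM: "p \<in> M" using closed_sequentially[OF M(2)] m(1) p by blast
  have "(\<lambda>n. norm (x - m n)) \<longlonglongrightarrow> norm (x - p)" by (intro tendsto_intros p)
  then have np: "norm (x - p) = d" using lim LIMSEQ_unique by blast
  have "cinner (x - p) q = 0" if q: "q \<in> M" for q
  proof (rule ccontr)
    let ?u = "x - p" and ?z = "cinner (x - p) q"
    assume z: "?z \<noteq> 0"
    \<comment> \<open>With this step size, moving \<open>p\<close> by \<open>s * ?z\<close> times
      \<open>q\<close> lowers the squared distance by more than
      \<open>s * (cmod ?z)\<^sup>2\<close>, which contradicts minimality.\<close>
    define s where "s = 1 / ((norm q)\<^sup>2 + 1)"
    have s: "s > 0" "s * (norm q)\<^sup>2 < 1"
      by (simp_all add: s_def add_nonneg_pos divide_less_eq)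
    let ?c = "complex_of_real s * ?z"
    have "p + ?c *\<^sub>C q \<in> M" by (intro cvs.subspace_scale cvs.subspace_add pM q M)
    from dle[OF this] have "d \<le> norm (?u - ?c *\<^sub>C q)" by (simp add: algebra_simps)
    then have "d\<^sup>2 \<le> (norm (?u - ?c *\<^sub>C q))\<^sup>2" using d0 by (simp add: power_mono)
    also have "\<dots> = d\<^sup>2 - 2 * (s * (cmod ?z)\<^sup>2) + (s * cmod ?z * norm q)\<^sup>2"
    proof -
      have "Re (cinner ?u (?c *\<^sub>C q)) = s * Re (?z * cnj ?z)"
        by (simp add: cinner_scaleC_right algebra_simps)
      also have "\<dots> = s * (cmod ?z)\<^sup>2"
        by (metis complex_norm_square Re_complex_of_real)
      finally show ?thesis using s by (simp add: norm_diff_sq np norm_scaleC norm_mult)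
    qed
    finally have "2 * (s * (cmod ?z)\<^sup>2) \<le> (s * (norm q)\<^sup>2) * (s * (cmod ?z)\<^sup>2)"
      by (simp add: power_mult_distrib power2_eq_square algebra_simps)
    moreover have "s * (cmod ?z)\<^sup>2 > 0" using s z by simp
    ultimately show False using s(2)
      by (smt (verit) mult_less_cancel_right2 mult_right_mono)
  qed
  then show ?thesis using pM that by blast
qed

lemma closed_subspace_eq_UNIV:
  fixes M :: "'a::chilbert set"
  assumes "cvs.subspace M" "closed M" "\<And>u. (\<And>q. q \<in> M \<Longrightarrow> cinner u q = 0) \<Longrightarrow> u = 0"
  shows "M = UNIV"
proof -
  have "x \<in> M" for x
  proof -
    obtain p where "p \<in> M" "\<And>q. q \<in> M \<Longrightarrow> cinner (x - p) q = 0"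
      using ex_orthogonal_projection[OF assms(1,2)] by blast
    then show ?thesis using assms(3)[of "x - p"] by simp
  qed
  then show ?thesis by blast
qed

section \<open>Self-adjoint relations and their resolvents\<close>

lemma lin_rel_zero: "lin_rel T \<Longrightarrow> (0, 0) \<in> T"
  by (simp add: lin_rel_def)

lemma lin_rel_add: "lin_rel T \<Longrightarrow> (x, f) \<in> T \<Longrightarrow> (y, g) \<in> T \<Longrightarrow> (x + y, f + g) \<in> T"
  by (simp add: lin_rel_def)

lemma lin_rel_scaleC: "lin_rel T \<Longrightarrow> (x, f) \<in> T \<Longrightarrow> (c *\<^sub>C x, c *\<^sub>C f) \<in> T"
  by (simp add: lin_rel_def)

lemma lin_rel_diff: "lin_rel T \<Longrightarrow> (x, f) \<in> T \<Longrightarrow> (y, g) \<in> T \<Longrightarrow> (x - y, f - g) \<in> T"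
  using lin_rel_add[of T x f "- y" "- g"] lin_rel_scaleC[of T y g "- 1"] by simp

text \<open>Membership is a family of equations between inner products, and these survive limits.
  Self-adjoint relations inherit closedness from this.\<close>

lemma closed_radjoint: "closed (radjoint T)"
  unfolding closed_sequential_limits
proof clarify
  fix p :: "nat \<Rightarrow> 'a \<times> 'a" and y g
  assume p: "\<forall>n. p n \<in> radjoint T" "p \<longlonglongrightarrow> (y, g)"
  have "cinner g x = cinner y f" if "(x, f) \<in> T" for x f
  proof (rule LIMSEQ_unique)
    show "(\<lambda>n. cinner (snd (p n)) x) \<longlonglongrightarrow> cinner g x"
      using tendsto_snd[OF p(2)] by (intro cinner.tendsto) auto
    have "cinner (snd (p n)) x = cinner (fst (p n)) f" for n
      using p(1)[rule_format, of n] that by (auto simp: radjoint_def)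
    then show "(\<lambda>n. cinner (snd (p n)) x) \<longlonglongrightarrow> cinner y f"
      using tendsto_fst[OF p(2)] by (auto intro!: cinner.tendsto)
  qed
  then show "(y, g) \<in> radjoint T" by (auto simp: radjoint_def)
qed

lemma hermitianD: "hermitian T \<Longrightarrow> (x, f) \<in> T \<Longrightarrow> (y, g) \<in> T \<Longrightarrow> cinner g x = cinner y f"
  by (auto simp: hermitian_def radjoint_def)

lemma selfadjoint_imp_hermitian: "selfadjoint T \<Longrightarrow> hermitian T"
  by (simp add: selfadjoint_def hermitian_def)

lemma selfadjoint_imp_closed: "selfadjoint T \<Longrightarrow> closed T"
  by (metis selfadjoint_def closed_radjoint)

lemma selfadjoint_memI:
  assumes "selfadjoint T" "\<And>x f. (x, f) \<in> T \<Longrightarrow> cinner g x = cinner y f"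
  shows "(y, g) \<in> T"
proof -
  have "(y, g) \<in> radjoint T" using assms(2) by (simp add: radjoint_def)
  then show ?thesis using assms(1) by (metis selfadjoint_def)
qed

lemma hermitian_Im_zero: "hermitian T \<Longrightarrow> (x, f) \<in> T \<Longrightarrow> Im (cinner f x) = 0"
  using hermitianD[of T x f x f] cinner_commute[of x f] by (simp add: complex_eq_iff)

lemma closed_relD:
  assumes "closed T" "\<And>n. (x n, f n) \<in> T" "x \<longlonglongrightarrow> a" "f \<longlonglongrightarrow> b"
  shows "(a, b) \<in> T"
  using closed_sequentially[OF assms(1) assms(2) tendsto_Pair[OF assms(3,4)]] .

section \<open>Resolvents as bounded operators and criteria for resolvent points\<close>

lemma resolvent_rel_iff: "(w, x) \<in> resolvent_rel l T \<longleftrightarrow> (x, l *\<^sub>C x - w) \<in> T"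
proof -
  have "(x, f) \<in> T \<and> w = l *\<^sub>C x - f \<longleftrightarrow> f = l *\<^sub>C x - w \<and> (x, l *\<^sub>C x - w) \<in> T" for f
    by auto
  then show ?thesis by (auto simp: resolvent_rel_def)
qed

lemma lin_rel_resolvent_rel:
  assumes "lin_rel T" shows "lin_rel (resolvent_rel l T)"
  unfolding lin_rel_def resolvent_rel_iff
proof (intro conjI allI impI)
  fix w x v y c
  assume a: "(x, l *\<^sub>C x - w) \<in> T"
  show "(c *\<^sub>C x, l *\<^sub>C c *\<^sub>C x - c *\<^sub>C w) \<in> T"
    using lin_rel_scaleC[OF assms a, of c] by (simp add: scaleC.diff_right mult.commute)
  assume b: "(y, l *\<^sub>C y - v) \<in> T"
  show "(x + y, l *\<^sub>C (x + y) - (w + v)) \<in> T"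
    using lin_rel_add[OF assms a b] by (simp add: algebra_simps scaleC_add_right)
qed (simp add: lin_rel_zero[OF assms])

text \<open>Replaces the inverse relation by a function. \<open>bounded_linear\<close> records real
  linearity only; complex homogeneity is recovered where it is used.\<close>

lemma resolvent_set_obtain:
  assumes T: "lin_rel T" and l: "l \<in> rel_resolvent_set T"
  obtains B where "bounded_linear B" "\<And>w. (B w, l *\<^sub>C B w - w) \<in> T"
    "\<And>x f. (x, f) \<in> T \<Longrightarrow> B (l *\<^sub>C x - f) = x"
proof -
  let ?R = "resolvent_rel l T"
  have R: "lin_rel ?R" "\<And>y. \<exists>!x. (y, x) \<in> ?R"
    using l by (auto simp: rel_resolvent_set_def bounded_everywhere_op_def)
  obtain K where K: "\<And>y x. (y, x) \<in> ?R \<Longrightarrow> norm x \<le> K * norm y"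
    using l by (auto simp: rel_resolvent_set_def bounded_everywhere_op_def)
  define B where "B = (\<lambda>y. THE x. (y, x) \<in> ?R)"
  have B: "(y, B y) \<in> ?R" for y unfolding B_def by (rule theI') (rule R)
  have Beq: "B y = x" if "(y, x) \<in> ?R" for x y using R(2)[of y] B[of y] that by blast
  have "bounded_linear B"
  proof (rule bounded_linear_intro)
    show "B (x + y) = B x + B y" for x y by (intro Beq lin_rel_add R(1) B)
    show "B (r *\<^sub>R x) = r *\<^sub>R B x" for r x unfolding scaleR_scaleC by (intro Beq lin_rel_scaleC R(1) B)
    show "norm (B x) \<le> norm x * K" for x using K[OF B[of x]] by (simp add: mult.commute)
  qed
  moreover have "(B w, l *\<^sub>C B w - w) \<in> T" for w using B[of w] by (simp add: resolvent_rel_iff)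
  moreover have "B (l *\<^sub>C x - f) = x" if "(x, f) \<in> T" for x f
    using that by (intro Beq) (simp add: resolvent_rel_iff)
  ultimately show ?thesis using that by blast
qed

text \<open>The lower bound and closedness of \<open>T\<close> make the range of
  \<open>l - T\<close> closed. By self-adjointness, the orthogonal complement of the range is the
  kernel at \<open>cnj l\<close>, which \<open>ker\<close> makes trivial; so the range is the whole
  space.\<close>

lemma resolvent_setI:
  fixes T :: "('a::chilbert \<times> 'a) set"
  assumes T: "lin_rel T" "selfadjoint T" and d: "d > 0"
    and bd: "\<And>x f. (x, f) \<in> T \<Longrightarrow> d * norm x \<le> norm (l *\<^sub>C x - f)"
    and ker: "\<And>u. (u, cnj l *\<^sub>C u) \<in> T \<Longrightarrow> u = 0"
  shows "l \<in> rel_resolvent_set T"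
proof -
  let ?R = "resolvent_rel l T"
  have R: "lin_rel ?R" by (rule lin_rel_resolvent_rel[OF T(1)])
  define M where "M = {w. \<exists>x. (w, x) \<in> ?R}"
  have Rbd: "d * norm x \<le> norm w" if "(w, x) \<in> ?R" for w x
    using that bd by (force simp: resolvent_rel_iff)
  have "cvs.subspace M"
    using lin_rel_zero[OF R] lin_rel_add[OF R] lin_rel_scaleC[OF R]
    unfolding cvs.subspace_def M_def by blast
  moreover have "closed M"
    unfolding closed_sequential_limits
  proof (intro allI impI, elim conjE)
    fix w a assume "\<forall>n. w n \<in> M" and w: "w \<longlonglongrightarrow> a"
    then obtain x where x: "\<And>n. (w n, x n) \<in> ?R" unfolding M_def by simp metis
    have "Cauchy x"
    proof (rule CauchyI)
      fix e :: real assume e: "0 < e"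
      have "Cauchy w" using w LIMSEQ_imp_Cauchy by blast
      then obtain N where N: "\<And>m n. m \<ge> N \<Longrightarrow> n \<ge> N \<Longrightarrow> norm (w m - w n) < d * e"
        using CauchyD[of w "d * e"] d e by auto
      have "norm (x m - x n) < e" if "m \<ge> N" "n \<ge> N" for m n
      proof -
        have "d * norm (x m - x n) < d * e"
          using Rbd[OF lin_rel_diff[OF R x[of m] x[of n]]] N[OF that] by linarith
        then show ?thesis using d by simp
      qed
      then show "\<exists>N. \<forall>m\<ge>N. \<forall>n\<ge>N. norm (x m - x n) < e" by blast
    qed
    then obtain b where b: "x \<longlonglongrightarrow> b" using Cauchy_convergent convergentD by blast
    have "(b, l *\<^sub>C b - a) \<in> T"
    proof (rule closed_relD[OF selfadjoint_imp_closed[OF T(2)]])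
      show "(x n, l *\<^sub>C x n - w n) \<in> T" for n using x[of n] by (simp add: resolvent_rel_iff)
      show "(\<lambda>n. l *\<^sub>C x n - w n) \<longlonglongrightarrow> l *\<^sub>C b - a"
        by (intro tendsto_diff scaleC.tendsto tendsto_const b w)
    qed (rule b)
    then show "a \<in> M" unfolding M_def resolvent_rel_iff by blast
  qed
  moreover have "u = 0" if u: "\<And>q. q \<in> M \<Longrightarrow> cinner u q = 0" for u
  \<comment> \<open>Orthogonality of \<open>u\<close> to the range says precisely that
    \<open>(u, cnj l *\<^sub>C u)\<close> lies in the adjoint of \<open>T\<close>.\<close>
  proof (rule ker, rule selfadjoint_memI[OF T(2)])
    fix x f assume "(x, f) \<in> T"
    then have "l *\<^sub>C x - f \<in> M" by (auto simp: M_def resolvent_rel_iff intro!: exI[of _ x])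
    from u[OF this] show "cinner (cnj l *\<^sub>C u) x = cinner u f"
      by (simp add: cinner_diff_right cinner_scaleC_right cinner_scaleC_left)
  qed
  ultimately have "M = UNIV" by (rule closed_subspace_eq_UNIV)
  then have ex: "\<exists>x. (w, x) \<in> ?R" for w unfolding M_def by blast
  have uniq: "x = y" if "(w, x) \<in> ?R" "(w, y) \<in> ?R" for w x y
    using Rbd[OF lin_rel_diff[OF R that]] d by (simp add: mult_le_0_iff)
  have "\<forall>w x. (w, x) \<in> ?R \<longrightarrow> norm x \<le> (1 / d) * norm w"
    using Rbd d by (simp add: field_simps)
  then show ?thesis
    unfolding rel_resolvent_set_def bounded_everywhere_op_def using R ex uniq by blast
qed

text \<open>Since \<open>cinner f x\<close> is real, pairing \<open>l *\<^sub>C x - f\<close> with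
  \<open>x\<close> has imaginary part \<open>Im l * (norm x)\<^sup>2\<close>; Cauchy-Schwarz does
  the rest.\<close>

lemma hermitian_bounded_below_Im:
  assumes "hermitian T" "(x, f) \<in> T"
  shows "\<bar>Im l\<bar> * norm x \<le> norm (l *\<^sub>C x - f)"
proof (cases "x = 0")
  case False
  have "Im (cinner (l *\<^sub>C x - f) x) = Im l * (norm x)\<^sup>2"
    using hermitian_Im_zero[OF assms]
    by (simp add: cinner_diff_left cinner_scaleC_left norm_cinner[symmetric])
  then have "\<bar>Im l\<bar> * (norm x)\<^sup>2 \<le> cmod (cinner (l *\<^sub>C x - f) x)"
    using abs_Im_le_cmod[of "cinner (l *\<^sub>C x - f) x"] by (simp add: abs_mult)
  also have "\<dots> \<le> norm (l *\<^sub>C x - f) * norm x" by (rule Cauchy_Schwarz_cinner)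
  finally show ?thesis using False by (simp add: power2_eq_square)
qed simp

lemma selfadjoint_nonreal_resolvent:
  assumes T: "lin_rel T" "selfadjoint T" and "Im l \<noteq> 0"
  shows "l \<in> rel_resolvent_set T"
proof (rule resolvent_setI[OF T])
  show "0 < \<bar>Im l\<bar>" using assms by simp
  show "\<bar>Im l\<bar> * norm x \<le> norm (l *\<^sub>C x - f)" if "(x, f) \<in> T" for x f
    by (rule hermitian_bounded_below_Im[OF selfadjoint_imp_hermitian[OF T(2)] that])
  show "u = 0" if "(u, cnj l *\<^sub>C u) \<in> T" for u
    using hermitian_bounded_below_Im[OF selfadjoint_imp_hermitian[OF T(2)] that, of "cnj l"] assms(3)
    by (simp add: mult_le_0_iff)
qed

text \<open>For real \<open>l\<close> the kernel condition of \<open>resolvent_setI\<close> follows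
  from the lower bound itself.\<close>

lemma selfadjoint_real_resolvent:
  assumes T: "lin_rel T" "selfadjoint T" and "Im l = 0" and d: "d > 0"
    and bd: "\<And>x f. (x, f) \<in> T \<Longrightarrow> d * norm x \<le> norm (l *\<^sub>C x - f)"
  shows "l \<in> rel_resolvent_set T"
proof (rule resolvent_setI[OF T d bd])
  have "cnj l = l" using assms(3) by (simp add: complex_eq_iff)
  then show "u = 0" if "(u, cnj l *\<^sub>C u) \<in> T" for u
    using bd[OF that] d by (simp add: mult_le_0_iff)
qed

section \<open>Finite-dimensional eigenspaces and semi-Fredholm points\<close>

definition orthonormal :: "'a::chilbert set \<Rightarrow> bool" where
  "orthonormal F \<longleftrightarrow> (\<forall>x\<in>F. norm x = 1) \<and> (\<forall>x\<in>F. \<forall>y\<in>F. x \<noteq> y \<longrightarrow> cinner x y = 0)"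

lemma orthonormal_cinner:
  "orthonormal F \<Longrightarrow> x \<in> F \<Longrightarrow> y \<in> F \<Longrightarrow> cinner x y = (if x = y then 1 else 0)"
  using norm_cinner[of x] by (auto simp: orthonormal_def)

lemma cinner_sum_orthonormal:
  assumes "finite F" "orthonormal F" "y \<in> F"
  shows "cinner (\<Sum>x\<in>F. c x *\<^sub>C x) y = c y"
proof -
  have "cinner (\<Sum>x\<in>F. c x *\<^sub>C x) y = (\<Sum>x\<in>F. c x * (if x = y then 1 else 0))"
    by (simp add: cinner.sum_left cinner_scaleC_left orthonormal_cinner[OF assms(2) _ assms(3)])
  also have "\<dots> = (\<Sum>x\<in>F. if x = y then c x else 0)" by (intro sum.cong) auto
  also have "\<dots> = c y" using assms(1,3) by simp
  finally show ?thesis .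
qed

lemma orthonormal_imp_cindependent:
  assumes "finite F" "orthonormal F" shows "cindependent F"
  unfolding cindependent_def
  using cinner_sum_orthonormal[OF assms] by (metis cinner_zero_left)

lemma orthonormal_insert:
  assumes "orthonormal F" "norm v = 1" "\<And>e. e \<in> F \<Longrightarrow> cinner v e = 0"
  shows "orthonormal (insert v F)" "v \<notin> F"
proof -
  have "cinner e v = 0" if "e \<in> F" for e
    using assms(3)[OF that] cinner_commute[of e v] by simp
  then show "orthonormal (insert v F)" using assms unfolding orthonormal_def by auto
  show "v \<notin> F" using assms(2,3) by (metis cinner_eq_zero_iff norm_zero zero_neq_one)
qed

text \<open>A nonzero remainder of the expansion would, once normalised, be a unit vector of
  \<open>M\<close> orthogonal to \<open>F\<close>, against maximality.\<close>

lemma orthonormal_maximal_expansion: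
  assumes M: "cvs.subspace M" and F: "F \<subseteq> M" "finite F" "orthonormal F"
    and max: "\<And>v. v \<in> M \<Longrightarrow> norm v = 1 \<Longrightarrow> \<exists>e\<in>F. cinner v e \<noteq> 0"
    and x: "x \<in> M"
  shows "x = (\<Sum>e\<in>F. cinner x e *\<^sub>C e)"
proof (rule ccontr)
  define y where "y = x - (\<Sum>e\<in>F. cinner x e *\<^sub>C e)"
  assume "\<not> ?thesis"
  then have y0: "y \<noteq> 0" by (simp add: y_def)
  have yM: "y \<in> M" unfolding y_def using F(1)
    by (intro cvs.subspace_diff cvs.subspace_sum cvs.subspace_scale M x) auto
  have ye: "cinner y e = 0" if "e \<in> F" for e
    using cinner_sum_orthonormal[OF F(2,3) that, of "cinner x"] by (simp add: y_def cinner_diff_left)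
  define v where "v = complex_of_real (1 / norm y) *\<^sub>C y"
  have "v \<in> M" unfolding v_def by (intro cvs.subspace_scale M yM)
  moreover have "norm v = 1" using y0 unfolding v_def norm_scaleC norm_of_real by simp
  moreover have "\<forall>e\<in>F. cinner v e = 0" using ye unfolding v_def cinner_scaleC_left by simp
  ultimately show False using max by blast
qed

lemma cindependent_imp_independent:
  assumes "finite F" "cindependent F" shows "cvs.independent F"
  using assms by (auto simp: cvs.independent_if_scalars_zero cindependent_def)

text \<open>If no such vector existed, \<open>M\<close> would lie in the span of \<open>F\<close> by
  the expansion above, yet it contains an independent set with one element more than
  \<open>F\<close>.\<close>

lemma infinite_dim_orthonormal_extend:
  assumes M: "cvs.subspace M" "infinite_dim M" and F: "F \<subseteq> M" "finite F" "orthonormal F"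
  obtains v where "v \<in> M" "norm v = 1" "\<And>e. e \<in> F \<Longrightarrow> cinner v e = 0"
proof (rule ccontr)
  assume "\<not> thesis"
  then have max: "\<exists>e\<in>F. cinner v e \<noteq> 0" if "v \<in> M" "norm v = 1" for v
    using that \<open>\<And>v. \<lbrakk>v \<in> M; norm v = 1; \<And>e. e \<in> F \<Longrightarrow> cinner v e = 0\<rbrakk> \<Longrightarrow> thesis\<close> by blast
  obtain G where G: "G \<subseteq> M" "finite G" "card G = Suc (card F)" "cindependent G"
    using M(2) unfolding infinite_dim_def by blast
  have "x \<in> cvs.span F" if "x \<in> M" for x
  proof -
    have "(\<Sum>e\<in>F. cinner x e *\<^sub>C e) \<in> cvs.span F"
      by (rule cvs.span_sum, rule cvs.span_scale, rule cvs.span_base)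
    then show ?thesis
      using orthonormal_maximal_expansion[OF M(1) F max that] by simp
  qed
  then have "G \<subseteq> cvs.span F" using G(1) by blast
  then have "card G \<le> card F"
    using cvs.independent_span_bound[OF F(2) cindependent_imp_independent[OF G(2,4)]] by blast
  then show False using G(3) by simp
qed

lemma infinite_dim_orthonormal:
  assumes M: "cvs.subspace M" "infinite_dim M"
  shows "\<exists>F. F \<subseteq> M \<and> finite F \<and> orthonormal F \<and> card F = n"
proof (induction n)
  case 0
  show ?case by (rule exI[of _ "{}"]) (simp add: orthonormal_def)
next
  case (Suc n)
  then obtain F where F: "F \<subseteq> M" "finite F" "orthonormal F" "card F = n" by blast
  obtain v where v: "v \<in> M" "norm v = 1" "\<And>e. e \<in> F \<Longrightarrow> cinner v e = 0"
    using infinite_dim_orthonormal_extend[OF M F(1-3)] by blast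
  show ?case
    using orthonormal_insert[OF F(3) v(2,3)] F v(1) by (intro exI[of _ "insert v F"]) auto
qed

text \<open>Distinct orthonormal vectors have distance \<open>sqrt 2\<close>. A finite cover by
  balls of radius 1/2 would put two of them into one ball, hence at distance below 1.\<close>

lemma infinite_dim_not_compact:
  assumes M: "cvs.subspace M" "infinite_dim M"
  shows "\<not> compact (M \<inter> cball 0 1)"
proof
  assume "compact (M \<inter> cball 0 1)"
  then obtain k where k: "finite k" "M \<inter> cball 0 1 \<subseteq> (\<Union>x\<in>k. ball x (1/2))"
    unfolding compact_eq_totally_bounded by (meson half_gt_zero zero_less_one)
  obtain F where F: "F \<subseteq> M" "finite F" "orthonormal F" "card F = Suc (card k)"
    using infinite_dim_orthonormal[OF M] by blast
  have "\<exists>c\<in>k. e \<in> ball c (1/2)" if "e \<in> F" for e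
  proof -
    have "e \<in> M \<inter> cball 0 1" using that F(1,3) by (auto simp: orthonormal_def)
    then show ?thesis using k(2) by blast
  qed
  then obtain h where h: "\<And>e. e \<in> F \<Longrightarrow> h e \<in> k" "\<And>e. e \<in> F \<Longrightarrow> dist (h e) e < 1/2"
    by (metis mem_ball)
  have "card (h ` F) \<le> card k" using h(1) k(1) by (intro card_mono) auto
  then have "\<not> inj_on h F" using F(2,4) card_image by fastforce
  then obtain x y where xy: "x \<in> F" "y \<in> F" "x \<noteq> y" "h x = h y" by (auto simp: inj_on_def)
  have "dist x y < 1"
    using dist_triangle_half_r[of "h x" x 1 y] h(2)[OF xy(1)] h(2)[OF xy(2)] xy(4) by simp
  then have "(norm (x - y))\<^sup>2 < 1" by (simp add: dist_norm power_less_one_iff)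
  moreover have "(norm (x - y))\<^sup>2 = 2"
    using F(3) xy by (simp add: norm_diff_sq orthonormal_def)
  ultimately show False by simp
qed

lemma finite_bounded_convergent_subsequence:
  fixes c :: "'i \<Rightarrow> nat \<Rightarrow> complex"
  assumes "finite F" "\<And>e. e \<in> F \<Longrightarrow> bounded (range (c e))"
  shows "\<exists>r. strict_mono (r::nat \<Rightarrow> nat) \<and> (\<forall>e\<in>F. convergent (c e \<circ> r))"
  using assms
proof (induction F rule: finite_induct)
  case empty
  show ?case by (rule exI[of _ id]) (simp add: strict_mono_def)
next
  case (insert a F)
  have "\<exists>r. strict_mono (r::nat \<Rightarrow> nat) \<and> (\<forall>e\<in>F. convergent (c e \<circ> r))"
    by (rule insert.IH) (use insert.prems in auto)
  then obtain r where r: "strict_mono (r::nat \<Rightarrow> nat)" "\<forall>e\<in>F. convergent (c e \<circ> r)" by blast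
  have "bounded (range (c a \<circ> r))"
    by (rule bounded_subset[of "range (c a)"]) (use insert.prems in auto)
  then obtain l s where s: "strict_mono (s::nat \<Rightarrow> nat)" "((c a \<circ> r) \<circ> s) \<longlonglongrightarrow> l"
    using bounded_imp_convergent_subsequence by blast
  have "convergent (c e \<circ> (r \<circ> s))" if "e \<in> insert a F" for e
  proof (cases "e = a")
    case True
    then show ?thesis using s(2) by (auto simp: convergent_def o_assoc)
  next
    case False
    then show ?thesis
      using r(2) that convergent_subseq_convergent[OF _ s(1), of "c e \<circ> r"] by (auto simp: o_assoc)
  qed
  then show ?case using strict_mono_o[OF r(1) s(1)] by blast
qed

text \<open>Bolzano-Weierstrass in coordinates: all coefficients with respect to a maximal finite
  orthonormal set converge along a common subsequence.\<close>

lemma finite_dim_convergent_subsequence: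
  assumes M: "cvs.subspace M" "\<not> infinite_dim M"
    and x: "\<And>n. x n \<in> M" "bounded (range x)"
  shows "\<exists>r. strict_mono (r::nat \<Rightarrow> nat) \<and> convergent (x \<circ> r)"
proof -
  let ?P = "\<lambda>F. F \<subseteq> M \<and> finite F \<and> orthonormal F"
  define Q where "Q F \<longleftrightarrow> (\<forall>v\<in>M. norm v = 1 \<longrightarrow> (\<exists>e\<in>F. cinner v e \<noteq> 0))" for F
  \<comment> \<open>If every finite orthonormal set could be enlarged, there would be independent
    sets of every size in \<open>M\<close>.\<close>
  have "\<exists>F. ?P F \<and> Q F"
  proof (rule ccontr)
    assume "\<not> (\<exists>F. ?P F \<and> Q F)"
    then have ext: "\<exists>v\<in>M. norm v = 1 \<and> (\<forall>e\<in>F. cinner v e = 0)" if "?P F" for F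
      using that unfolding Q_def by meson
    have "\<exists>F. ?P F \<and> card F = n" for n
    proof (induction n)
      case 0
      show ?case by (rule exI[of _ "{}"]) (simp add: orthonormal_def)
    next
      case (Suc n)
      then obtain F where F: "?P F" "card F = n" by blast
      obtain v where v: "v \<in> M" "norm v = 1" "\<And>e. e \<in> F \<Longrightarrow> cinner v e = 0"
        using ext[OF F(1)] by blast
      show ?case
        using orthonormal_insert[of F v] F v by (intro exI[of _ "insert v F"]) auto
    qed
    then have "infinite_dim M"
      unfolding infinite_dim_def using orthonormal_imp_cindependent by metis
    then show False using M(2) by simp
  qed
  then obtain F where F: "F \<subseteq> M" "finite F" "orthonormal F"
    and max: "\<And>v. v \<in> M \<Longrightarrow> norm v = 1 \<Longrightarrow> \<exists>e\<in>F. cinner v e \<noteq> 0"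
    unfolding Q_def by blast
  obtain K where K: "\<And>n. norm (x n) \<le> K" using x(2) by (auto simp: bounded_iff)
  have "bounded (range (\<lambda>n. cinner (x n) e))" for e
  proof -
    have "cmod (cinner (x n) e) \<le> K * norm e" for n
      using Cauchy_Schwarz_cinner[of "x n" e] mult_right_mono[OF K[of n], of "norm e"] by simp
    then show ?thesis by (auto simp: bounded_iff)
  qed
  then obtain r where r: "strict_mono (r::nat \<Rightarrow> nat)"
    "\<And>e. e \<in> F \<Longrightarrow> convergent ((\<lambda>n. cinner (x n) e) \<circ> r)"
    using finite_bounded_convergent_subsequence[OF F(2), of "\<lambda>e n. cinner (x n) e"] by blast
  then obtain L where L: "\<And>e. e \<in> F \<Longrightarrow> (\<lambda>n. cinner (x (r n)) e) \<longlonglongrightarrow> L e"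
    unfolding convergent_def o_def by metis
  have "(\<lambda>n. \<Sum>e\<in>F. cinner (x (r n)) e *\<^sub>C e) \<longlonglongrightarrow> (\<Sum>e\<in>F. L e *\<^sub>C e)"
    by (intro tendsto_sum scaleC.tendsto L tendsto_const)
  moreover have "(\<Sum>e\<in>F. cinner (x (r n)) e *\<^sub>C e) = x (r n)" for n
    using orthonormal_maximal_expansion[OF M(1) F max x(1)] by metis
  ultimately have "convergent (x \<circ> r)" by (auto simp: convergent_def o_def)
  then show ?thesis using r(1) by blast
qed

section \<open>Semi-Fredholm points\<close>

text \<open>For closed \<open>T\<close> this is the sequential form of "\<open>T - l\<close> has
  closed range and finite-dimensional kernel". It suits perturbations that converge along
  subsequences.\<close>

definition semi_fredholm :: "'a::chilbert rel2 \<Rightarrow> complex \<Rightarrow> bool" where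
  "semi_fredholm T l \<longleftrightarrow> (\<forall>x f. (\<forall>n. (x n, f n) \<in> T) \<longrightarrow> bounded (range x) \<longrightarrow>
     convergent (\<lambda>n. f n - l *\<^sub>C x n) \<longrightarrow> (\<exists>r. strict_mono (r::nat \<Rightarrow> nat) \<and> convergent (x \<circ> r)))"

lemma semi_fredholmD:
  assumes "semi_fredholm T l" "\<And>n. (x n, f n) \<in> T" "bounded (range x)"
    "convergent (\<lambda>n. f n - l *\<^sub>C x n)"
  obtains r a where "strict_mono (r::nat \<Rightarrow> nat)" "(x \<circ> r) \<longlonglongrightarrow> a"
  using assms unfolding semi_fredholm_def convergent_def by metis

lemma subspace_eigenspace: "lin_rel T \<Longrightarrow> cvs.subspace (eigenspace T l)"
  unfolding cvs.subspace_def eigenspace_def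
  using lin_rel_zero[of T] lin_rel_add[of T] lin_rel_scaleC[of T]
  by (simp add: scaleC_add_right) (metis mult.commute scaleC_scaleC)

lemma closed_eigenspace:
  assumes "closed T" shows "closed (eigenspace T l)"
  unfolding closed_sequential_limits
proof (intro allI impI, elim conjE)
  fix x a assume x: "\<forall>n. x n \<in> eigenspace T l" "x \<longlonglongrightarrow> a"
  have "(a, l *\<^sub>C a) \<in> T"
  proof (rule closed_relD[OF assms _ x(2)])
    show "(x n, l *\<^sub>C x n) \<in> T" for n using x(1) by (simp add: eigenspace_def)
    show "(\<lambda>n. l *\<^sub>C x n) \<longlonglongrightarrow> l *\<^sub>C a" by (intro scaleC.tendsto tendsto_const x(2))
  qed
  then show "a \<in> eigenspace T l" by (simp add: eigenspace_def)
qed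

text \<open>For kernel vectors take \<open>f n = l *\<^sub>C x n\<close>: the differences are
  constantly 0, so the unit ball of the kernel is sequentially compact.\<close>

lemma semi_fredholm_finite_dim:
  assumes T: "lin_rel T" "closed T" and F: "semi_fredholm T l"
  shows "\<not> infinite_dim (eigenspace T l)"
proof
  let ?N = "eigenspace T l"
  assume "infinite_dim ?N"
  then have "\<not> compact (?N \<inter> cball 0 1)"
    by (rule infinite_dim_not_compact[OF subspace_eigenspace[OF T(1)]])
  moreover have "compact (?N \<inter> cball 0 1)"
    unfolding compact_def
  proof (intro allI impI)
    fix x :: "nat \<Rightarrow> 'a" assume x: "\<forall>n. x n \<in> ?N \<inter> cball 0 1"
    have "bounded (range x)"
      by (rule bounded_subset[OF bounded_cball]) (use x in blast)
    then obtain r a where r: "strict_mono (r::nat \<Rightarrow> nat)" "(x \<circ> r) \<longlonglongrightarrow> a"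
      using semi_fredholmD[OF F, of x "\<lambda>n. l *\<^sub>C x n"] x convergent_const[of "0::'a"]
      by (auto simp: eigenspace_def)
    have "closed (?N \<inter> cball 0 1)" using closed_eigenspace[OF T(2)] by blast
    then have "a \<in> ?N \<inter> cball 0 1" 
      by (rule closed_sequentially[OF _ _ r(2)]) (use x in simp)
    then show "\<exists>a\<in>?N \<inter> cball 0 1. \<exists>r. strict_mono (r::nat \<Rightarrow> nat) \<and> (x \<circ> r) \<longlonglongrightarrow> a"
      using r by blast
  qed
  ultimately show False by blast
qed

text \<open>Otherwise there are unit vectors orthogonal to the kernel whose defect
  \<open>f n - l *\<^sub>C x n\<close> tends to 0. A subsequential limit is a unit vector that lies
  in the kernel and is orthogonal to it.\<close>

lemma semi_fredholm_bounded_below: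
  assumes T: "lin_rel T" "closed T" and F: "semi_fredholm T l"
  obtains c where "c > 0" "\<And>x f. (x, f) \<in> T \<Longrightarrow> (\<And>u. u \<in> eigenspace T l \<Longrightarrow> cinner x u = 0) \<Longrightarrow>
    c * norm x \<le> norm (f - l *\<^sub>C x)"
proof (rule ccontr)
  let ?N = "eigenspace T l"
  assume no: "\<not> thesis"
  have "\<exists>x f. (x, f) \<in> T \<and> (\<forall>u\<in>?N. cinner x u = 0) \<and> norm x = 1 \<and>
      norm (f - l *\<^sub>C x) < inverse (real (Suc n))" for n
  proof -
    have "\<not> (\<forall>x f. (x, f) \<in> T \<longrightarrow> (\<forall>u\<in>?N. cinner x u = 0) \<longrightarrow>
        inverse (real (Suc n)) * norm x \<le> norm (f - l *\<^sub>C x))"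
      using no that[of "inverse (real (Suc n))"] by auto
    then obtain x f where xf: "(x, f) \<in> T" "\<forall>u\<in>?N. cinner x u = 0"
      "norm (f - l *\<^sub>C x) < inverse (real (Suc n)) * norm x" by (meson not_le)
    then have x0: "norm x > 0"
      by (metis mult_zero_right norm_ge_zero not_le order_le_less)
    define s where "s = complex_of_real (1 / norm x)"
    have "s *\<^sub>C f - l *\<^sub>C s *\<^sub>C x = s *\<^sub>C (f - l *\<^sub>C x)"
      by (simp add: scaleC.diff_right mult.commute)
    then have "norm (s *\<^sub>C f - l *\<^sub>C s *\<^sub>C x) = norm (f - l *\<^sub>C x) / norm x"
      unfolding s_def by (simp only: norm_scaleC norm_of_real) simp
    also have "\<dots> < inverse (real (Suc n))" using xf(3) x0 by (simp add: divide_less_eq)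
    finally have "norm (s *\<^sub>C f - l *\<^sub>C s *\<^sub>C x) < inverse (real (Suc n))" .
    moreover have "norm (s *\<^sub>C x) = 1"
      unfolding s_def norm_scaleC norm_of_real using x0 by simp
    moreover have "\<forall>u\<in>?N. cinner (s *\<^sub>C x) u = 0" using xf(2) by (simp add: cinner_scaleC_left)
    ultimately show ?thesis using lin_rel_scaleC[OF T(1) xf(1), of s] by blast
  qed
  then obtain x f where xf: "\<And>n. (x n, f n) \<in> T" "\<And>n u. u \<in> ?N \<Longrightarrow> cinner (x n) u = 0"
    "\<And>n. norm (x n) = 1" "\<And>n. norm (f n - l *\<^sub>C x n) < inverse (real (Suc n))"
    by metis
  have lim: "(\<lambda>n. f n - l *\<^sub>C x n) \<longlonglongrightarrow> 0"
    using LIMSEQ_inverse_real_of_nat xf(4)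
    by (auto intro!: Lim_null_comparison[of _ "\<lambda>n. inverse (real (Suc n))"] always_eventually less_imp_le
        simp del: of_nat_Suc)
  have "bounded (range x)" using xf(3) by (auto simp: bounded_iff)
  then obtain r a where r: "strict_mono (r::nat \<Rightarrow> nat)" "(x \<circ> r) \<longlonglongrightarrow> a"
    using semi_fredholmD[OF F, of x f] xf(1) lim convergentI by blast
  have xr: "(\<lambda>n. x (r n)) \<longlonglongrightarrow> a" using r(2) by (simp add: o_def)
  have "(\<lambda>n. f (r n) - l *\<^sub>C x (r n)) \<longlonglongrightarrow> 0"
    using LIMSEQ_subseq_LIMSEQ[OF lim r(1)] by (simp add: o_def)
  from tendsto_add[OF this scaleC.tendsto[OF tendsto_const xr, of l]]
  have "(\<lambda>n. f (r n)) \<longlonglongrightarrow> l *\<^sub>C a" by simp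
  then have aN: "a \<in> ?N" unfolding eigenspace_def
    using closed_relD[OF T(2) xf(1) xr] by blast
  have "(\<lambda>n. cinner (x (r n)) a) \<longlonglongrightarrow> cinner a a" by (intro cinner.tendsto xr tendsto_const)
  then have "cinner a a = 0" using xf(2)[OF aN] by (simp add: LIMSEQ_const_iff)
  then have "a = 0" by simp
  moreover have "norm a = 1"
    using tendsto_norm[OF xr] xf(3) by (simp add: LIMSEQ_const_iff)
  ultimately show False by simp
qed

text \<open>A spectral point \<open>m\<close> within \<open>c\<close> of \<open>l\<close> would be a
  resolvent point: \<open>m - T\<close> multiplies the kernel at \<open>l\<close> by
  \<open>m - l\<close> and is bounded below by \<open>c - cmod (m - l)\<close> on its
  complement.\<close>

lemma semi_fredholm_not_limpt:
  assumes T: "lin_rel T" "selfadjoint T" and F: "semi_fredholm T l"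
  shows "\<not> l islimpt rel_spectrum T"
proof
  let ?N = "eigenspace T l"
  note her = selfadjoint_imp_hermitian[OF T(2)] and cl = selfadjoint_imp_closed[OF T(2)]
  assume lim: "l islimpt rel_spectrum T"
  obtain c where c: "c > 0" "\<And>x f. (x, f) \<in> T \<Longrightarrow> (\<And>u. u \<in> ?N \<Longrightarrow> cinner x u = 0) \<Longrightarrow>
    c * norm x \<le> norm (f - l *\<^sub>C x)"
    using semi_fredholm_bounded_below[OF T(1) cl F] by blast
  obtain m where m: "m \<in> rel_spectrum T" "m \<noteq> l" "dist m l < c"
    using lim c(1) unfolding islimpt_approachable by blast
  have spec_real: "Im z = 0" if "z \<in> rel_spectrum T" for z
    using selfadjoint_nonreal_resolvent[OF T] that by (auto simp: rel_spectrum_def)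
  have "closure (rel_spectrum T) \<subseteq> {z. Im z = 0}"
    by (intro closure_minimal) (use spec_real in \<open>auto intro!: closed_Collect_eq continuous_intros\<close>)
  then have lreal: "cnj l = l" using lim by (auto simp: closure_def complex_eq_iff)
  \<comment> \<open>The smaller of the two lower bounds, one for each component of \<open>x\<close>;
    both are positive because \<open>0 < cmod (m - l) < c\<close>.\<close>
  define d where "d = min (cmod (m - l)) (c - cmod (m - l))"
  have d: "d > 0" using m by (simp add: d_def dist_norm)
  have "d * norm x \<le> norm (m *\<^sub>C x - f)" if xf: "(x, f) \<in> T" for x f
  proof -
    obtain n where n: "n \<in> ?N" "\<And>q. q \<in> ?N \<Longrightarrow> cinner (x - n) q = 0"
      using ex_orthogonal_projection[OF subspace_eigenspace[OF T(1)] closed_eigenspace[OF cl]] by blast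
    define y g where "y = x - n" and "g = f - l *\<^sub>C n"
    have yg: "(y, g) \<in> T" unfolding y_def g_def
      using n(1) by (intro lin_rel_diff T(1) xf) (simp add: eigenspace_def)
    have yn: "cinner y n = 0" using n y_def by simp
    have "cinner g n = cinner y (l *\<^sub>C n)"
      using hermitianD[OF her _ yg, of n "l *\<^sub>C n"] n(1) by (simp add: eigenspace_def)
    \<comment> \<open>\<open>T\<close> maps the complement of the kernel into the complement, so the
      two components of \<open>m *\<^sub>C x - f\<close> stay orthogonal and Pythagoras combines the
      bounds.\<close>
    then have gn: "cinner g n = 0" using yn by (simp add: cinner_scaleC_right)
    have "c * norm y \<le> norm (g - l *\<^sub>C y)" using c(2)[OF yg] n(2) y_def by blast
    also have "g - l *\<^sub>C y = (m - l) *\<^sub>C y - (m *\<^sub>C y - g)" by (simp add: scaleC.diff_left)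
    also have "norm \<dots> \<le> cmod (m - l) * norm y + norm (m *\<^sub>C y - g)"
      using norm_triangle_ineq4[of "(m - l) *\<^sub>C y"] by (simp add: norm_scaleC)
    finally have "(c - cmod (m - l)) * norm y \<le> norm (m *\<^sub>C y - g)" by (simp add: algebra_simps)
    moreover have "d * norm y \<le> (c - cmod (m - l)) * norm y"
      by (intro mult_right_mono) (simp_all add: d_def)
    ultimately have 1: "d * norm y \<le> norm (m *\<^sub>C y - g)" by linarith
    have 2: "d * norm n \<le> norm ((m - l) *\<^sub>C n)"
      unfolding norm_scaleC by (intro mult_right_mono) (simp_all add: d_def)
    have "m *\<^sub>C x - f = (m *\<^sub>C y - g) + (m - l) *\<^sub>C n"
      by (simp add: y_def g_def scaleC.diff_left scaleC.diff_right)
    moreover have "cinner (m *\<^sub>C y - g) ((m - l) *\<^sub>C n) = 0"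
      by (simp add: cinner_scaleC_right cinner_diff_left cinner_scaleC_left yn gn)
    ultimately have "(norm (m *\<^sub>C x - f))\<^sup>2 = (norm (m *\<^sub>C y - g))\<^sup>2 + (norm ((m - l) *\<^sub>C n))\<^sup>2"
      by (simp add: norm_add_sq)
    moreover have "(d * norm y)\<^sup>2 \<le> (norm (m *\<^sub>C y - g))\<^sup>2" using 1 d by (simp add: power_mono)
    moreover have "(d * norm n)\<^sup>2 \<le> (norm ((m - l) *\<^sub>C n))\<^sup>2" using 2 d by (simp add: power_mono)
    moreover have "(d * norm x)\<^sup>2 = (d * norm y)\<^sup>2 + (d * norm n)\<^sup>2"
      using norm_add_sq[of y n] yn by (simp add: y_def power_mult_distrib algebra_simps)
    ultimately have "(d * norm x)\<^sup>2 \<le> (norm (m *\<^sub>C x - f))\<^sup>2" by linarith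
    then show ?thesis by (rule power2_le_imp_le) simp
  qed
  then have "m \<in> rel_resolvent_set T"
    using selfadjoint_real_resolvent[OF T spec_real[OF m(1)] d] by blast
  then show False using m(1) by (simp add: rel_spectrum_def)
qed

lemma semi_fredholm_not_ess_spectrum:
  assumes T: "lin_rel T" "selfadjoint T" and F: "semi_fredholm T l"
  shows "l \<notin> ess_spectrum T"
  using semi_fredholm_not_limpt[OF T F]
    semi_fredholm_finite_dim[OF T(1) selfadjoint_imp_closed[OF T(2)] F]
  by (simp add: ess_spectrum_def)

section \<open>Isolated points of the spectrum\<close>

text \<open>Stands in for "norm equals spectral radius": \<open>below\<close> excludes every real
  number \<open>1 / t\<close> of modulus above \<open>1 / r\<close> from the approximate point
  spectrum of the symmetric \<open>B\<close>.\<close>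

lemma symmetric_operator_norm_le:
  fixes B :: "'a::chilbert \<Rightarrow> 'a"
  assumes B: "bounded_linear B" and sym: "\<And>w v. cinner (B w) v = cinner w (B v)" and r: "r > 0"
    and below: "\<And>t. t \<noteq> 0 \<Longrightarrow> \<bar>t\<bar> < r \<Longrightarrow> \<exists>c>0. \<forall>w. c * norm w \<le> norm (w - t *\<^sub>R B w)"
  shows "r * norm (B w) \<le> norm w"
proof -
  interpret B: bounded_linear B by (rule B)
  define b where "b = onorm B"
  have bB: "norm (B w) \<le> b * norm w" for w unfolding b_def by (rule onorm[OF B])
  have b0: "0 \<le> b" unfolding b_def by (rule onorm_pos_le[OF B])
  have "r * b \<le> 1"
  proof (rule ccontr)
    assume "\<not> r * b \<le> 1"
    then have rb: "1 < r * b" by simp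
    then have bpos: "b > 0" using r b0 by (cases "b = 0") auto
    \<comment> \<open>As \<open>1 - mB\<close> and \<open>1 + mB\<close> are bounded below, so is \<open>1 - m\<^sup>2B\<^sup>2\<close>; but
      \<open>\<parallel>w - m\<^sup>2B\<^sup>2w\<parallel>\<^sup>2 \<le> \<parallel>w\<parallel>\<^sup>2 - m\<^sup>2\<parallel>Bw\<parallel>\<^sup>2\<close>, which pushes the norm of B below \<open>b = 1/m\<close>.\<close>
    define m where "m = 1 / b"
    have m: "m > 0" "m < r" "m * b = 1" using bpos rb by (auto simp: m_def divide_less_eq)
    obtain c where c: "c > 0" "\<And>w. c * norm w \<le> norm (w - m *\<^sub>R B w)"
      using below[of m] m by auto
    obtain c' where c': "c' > 0" "\<And>w. c' * norm w \<le> norm (w - (- m) *\<^sub>R B w)"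
      using below[of "- m"] m by auto
    have mB: "m * norm (B w) \<le> norm w" for w
      using mult_left_mono[OF bB[of w], of m] m by (simp add: mult.assoc[symmetric])
    \<comment> \<open>The contraction factor of the improved bound on \<open>B\<close>. It is below
      1 since \<open>c * c'\<close> is positive; \<open>max 0\<close> keeps the radicand
      nonnegative.\<close>
    define q where "q = sqrt (max 0 (1 - (c * c')\<^sup>2))"
    have q: "0 \<le> q" "q < 1" "1 - (c * c')\<^sup>2 \<le> q\<^sup>2" using c(1) c'(1) by (auto simp: q_def)
    have "norm (B w) \<le> q * b * norm w" for w
    proof -
      define z where "z = w - m\<^sup>2 *\<^sub>R B (B w)"
      define v where "v = w + m *\<^sub>R B w"
      have "z = v - m *\<^sub>R B v"
        by (simp add: z_def v_def B.add B.scaleR scaleR_right_distrib power2_eq_square)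
      then have "c * norm v \<le> norm z" using c(2)[of v] by simp
      moreover have "c * (c' * norm w) \<le> c * norm v"
        using c'(2)[of w] c(1) by (simp add: v_def)
      ultimately have "(c * c') * norm w \<le> norm z" by simp
      then have "((c * c') * norm w)\<^sup>2 \<le> (norm z)\<^sup>2" using c(1) c'(1) by (intro power_mono) auto
      moreover have "(norm z)\<^sup>2 \<le> (norm w)\<^sup>2 - m\<^sup>2 * (norm (B w))\<^sup>2"
      proof -
        have "Re (cinner w (B (B w))) = (norm (B w))\<^sup>2"
          by (simp add: sym[symmetric] norm_sq_eq_cinner)
        then have "(norm z)\<^sup>2 = (norm w)\<^sup>2 - 2 * m\<^sup>2 * (norm (B w))\<^sup>2 + m\<^sup>2 * (m * norm (B (B w)))\<^sup>2"
          unfolding z_def norm_diff_sq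
          by (simp add: cinner.scaleR_right power_mult_distrib power2_eq_square)
        moreover have "m\<^sup>2 * (m * norm (B (B w)))\<^sup>2 \<le> m\<^sup>2 * (norm (B w))\<^sup>2"
          using mB[of "B w"] m(1) by (intro mult_left_mono power_mono) auto
        ultimately show ?thesis by linarith
      qed
      ultimately have "(m * norm (B w))\<^sup>2 \<le> (1 - (c * c')\<^sup>2) * (norm w)\<^sup>2"
        by (simp add: power_mult_distrib algebra_simps)
      also have "\<dots> \<le> q\<^sup>2 * (norm w)\<^sup>2" by (intro mult_right_mono q) simp
      finally have "(m * norm (B w))\<^sup>2 \<le> (q * norm w)\<^sup>2" by (simp add: power_mult_distrib)
      then have "m * norm (B w) \<le> q * norm w" by (rule power2_le_imp_le) (simp add: q)
      then have "b * (m * norm (B w)) \<le> b * (q * norm w)" by (rule mult_left_mono) (rule b0)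
      then show ?thesis using m(3) by (simp add: mult.assoc[symmetric] mult.commute[of b])
    qed
    then have "b \<le> q * b" unfolding b_def by (intro onorm_bound) (use q b0 b_def in auto)
    then show False using q(2) bpos by simp
  qed
  then have "(r * b) * norm w \<le> 1 * norm w" by (rule mult_right_mono) simp
  moreover have "r * norm (B w) \<le> r * (b * norm w)" using bB r by simp
  ultimately show ?thesis by (simp add: mult.assoc)
qed

lemma resolvent_symmetric:
  assumes "hermitian T" and "cnj l = l" and B: "\<And>w. (B w, l *\<^sub>C B w - w) \<in> T"
  shows "cinner (B w) v = cinner w (B v)"
  using hermitianD[OF assms(1) B[of v] B[of w]] assms(2)
  by (simp add: cinner_diff_left cinner_diff_right cinner_scaleC_left cinner_scaleC_right)

text \<open>The bound of the resolvent by the inverse distance to the spectrum. The operator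
  \<open>1 - tB\<close> is \<open>(a - t - T)B\<close>, so it is bounded below whenever
  \<open>a - t\<close> is a resolvent point.\<close>

lemma selfadjoint_distance_spectrum:
  assumes T: "lin_rel T" "selfadjoint T" and r: "r > 0"
    and res: "\<And>t. \<bar>t\<bar> < r \<Longrightarrow> complex_of_real (a + t) \<in> rel_resolvent_set T"
    and xf: "(x, f) \<in> T"
  shows "r * norm x \<le> norm (complex_of_real a *\<^sub>C x - f)"
proof -
  let ?l = "complex_of_real a"
  have "?l \<in> rel_resolvent_set T" using res[of 0] r by simp
  then obtain B where B: "bounded_linear B" "\<And>w. (B w, ?l *\<^sub>C B w - w) \<in> T"
    "\<And>x f. (x, f) \<in> T \<Longrightarrow> B (?l *\<^sub>C x - f) = x"
    by (rule resolvent_set_obtain[OF T(1)]) blast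
  have sym: "cinner (B w) v = cinner w (B v)" for w v
    by (rule resolvent_symmetric[OF selfadjoint_imp_hermitian[OF T(2)] _ B(2)]) simp
  have below: "\<exists>c>0. \<forall>w. c * norm w \<le> norm (w - t *\<^sub>R B w)" if t: "t \<noteq> 0" "\<bar>t\<bar> < r" for t
  proof -
    let ?m = "complex_of_real (a + (- t))"
    have "?m \<in> rel_resolvent_set T" using res[of "- t"] t by simp
    then obtain B' where B': "bounded_linear B'" "\<And>x f. (x, f) \<in> T \<Longrightarrow> B' (?m *\<^sub>C x - f) = x"
      by (rule resolvent_set_obtain[OF T(1)]) blast
    obtain K where K: "K > 0" "\<And>v. norm (B' v) \<le> norm v * K"
      using bounded_linear.pos_bounded[OF B'(1)] by blast
    have pos: "1 + \<bar>t\<bar> * K > 0" using K(1) by (simp add: add_pos_nonneg)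
    have "norm w \<le> (1 + \<bar>t\<bar> * K) * norm (w - t *\<^sub>R B w)" for w
    proof -
      have "?m *\<^sub>C B w - (?l *\<^sub>C B w - w) = w - t *\<^sub>R B w"
        unfolding scaleR_scaleC of_real_add of_real_minus scaleC_add_left scaleC.minus_left by simp
      then have "B' (w - t *\<^sub>R B w) = B w" using B'(2)[OF B(2)[of w]] by metis
      then have "norm (B w) \<le> norm (w - t *\<^sub>R B w) * K" using K(2) by metis
      then have "\<bar>t\<bar> * norm (B w) \<le> \<bar>t\<bar> * (norm (w - t *\<^sub>R B w) * K)" by (rule mult_left_mono) simp
      moreover have "norm w \<le> norm (w - t *\<^sub>R B w) + \<bar>t\<bar> * norm (B w)"
        using norm_triangle_ineq[of "w - t *\<^sub>R B w" "t *\<^sub>R B w"] by simp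
      ultimately show ?thesis by (simp add: algebra_simps)
    qed
    then show ?thesis
      \<comment> \<open>The constant comes from splitting \<open>w\<close> into
        \<open>w - t *\<^sub>R B w\<close> and \<open>t *\<^sub>R B w\<close>, the latter controlled
        by the bound \<open>K\<close> of the resolvent at \<open>a - t\<close>.\<close>
      using pos by (intro exI[of _ "1 / (1 + \<bar>t\<bar> * K)"]) (simp add: field_simps)
  qed
  show ?thesis
    using symmetric_operator_norm_le[OF B(1) sym r below, of "?l *\<^sub>C x - f"] B(3)[OF xf] by simp
qed

text \<open>Around \<open>a + s\<close> with \<open>s\<close> equal to \<open>e / 2\<close> or
  \<open>- e / 2\<close>, a ball of radius \<open>e / 2\<close> misses the spectrum. In the squared
  distance bound the terms in \<open>(norm x)\<^sup>2\<close> cancel, and the two signs give the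
  absolute value.\<close>

lemma selfadjoint_isolated_form_bound:
  assumes T: "lin_rel T" "selfadjoint T" and e: "e > 0"
    and res: "\<And>t. t \<noteq> 0 \<Longrightarrow> \<bar>t\<bar> < e \<Longrightarrow> complex_of_real (a + t) \<in> rel_resolvent_set T"
    and xf: "(x, f) \<in> T"
  defines "k \<equiv> f - complex_of_real a *\<^sub>C x"
  shows "e * \<bar>Re (cinner k x)\<bar> \<le> (norm k)\<^sup>2"
proof -
  have *: "2 * s * Re (cinner k x) \<le> (norm k)\<^sup>2" if s: "\<bar>s\<bar> = e / 2" for s
  proof -
    have "\<bar>s\<bar> * norm x \<le> norm (complex_of_real (a + s) *\<^sub>C x - f)"
    proof (rule selfadjoint_distance_spectrum[OF T _ _ xf])
      show "0 < \<bar>s\<bar>" using s e by simp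
      fix t assume "\<bar>t\<bar> < \<bar>s\<bar>"
      then have "s + t \<noteq> 0" "\<bar>s + t\<bar> < e" using s by linarith+
      then show "complex_of_real (a + s + t) \<in> rel_resolvent_set T"
        using res[of "s + t"] by (simp add: add.assoc)
    qed
    also have "complex_of_real (a + s) *\<^sub>C x - f = - (k - s *\<^sub>R x)"
      by (simp add: k_def scaleR_scaleC scaleC_add_left)
    finally have "\<bar>s\<bar> * norm x \<le> norm (k - s *\<^sub>R x)" by (simp only: norm_minus_cancel)
    then have "(\<bar>s\<bar> * norm x)\<^sup>2 \<le> (norm (k - s *\<^sub>R x))\<^sup>2" by (rule power_mono) simp
    then show ?thesis
      unfolding norm_diff_sq by (simp add: cinner.scaleR_right power_mult_distrib)
  qed
  show ?thesis using *[of "e / 2"] *[of "- e / 2"] e by (cases "Re (cinner k x) \<ge> 0") auto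
qed

section \<open>Symmetric operators bounded below on the closure of their range\<close>

lemma subspace_closure:
  fixes M :: "'a::chilbert set"
  assumes "cvs.subspace M" shows "cvs.subspace (closure M)"
  unfolding cvs.subspace_def
proof (intro conjI ballI allI)
  show "0 \<in> closure M" using cvs.subspace_0[OF assms] closure_subset by blast
next
  fix x y assume "x \<in> closure M" "y \<in> closure M"
  then obtain u v where "\<And>n. u n \<in> M" "u \<longlonglongrightarrow> x" "\<And>n. v n \<in> M" "v \<longlonglongrightarrow> y"
    unfolding closure_sequential by blast
  then show "x + y \<in> closure M"
    unfolding closure_sequential
    by (intro exI[of _ "\<lambda>n. u n + v n"]) (simp add: cvs.subspace_add[OF assms] tendsto_add)
next
  fix c x assume "x \<in> closure M"
  then obtain u where "\<And>n. u n \<in> M" "u \<longlonglongrightarrow> x"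
    unfolding closure_sequential by blast
  then show "c *\<^sub>C x \<in> closure M"
    unfolding closure_sequential
    by (intro exI[of _ "\<lambda>n. c *\<^sub>C u n"]) (simp add: cvs.subspace_scale[OF assms] scaleC.tendsto)
qed

text \<open>In spectral terms, \<open>0 <= C <= d C^2\<close> leaves no spectrum strictly between 0
  and \<open>1 / d\<close>, so \<open>C\<close> is bounded below by \<open>1 / d\<close> on its
  range.\<close>

lemma symmetric_range_bounded_below:
  fixes C :: "'a::chilbert \<Rightarrow> 'a"
  assumes C: "bounded_linear C" and sym: "\<And>w v. cinner (C w) v = cinner w (C v)"
    and nonneg: "\<And>w. 0 \<le> Re (cinner (C w) w)"
    and d: "d > 0" "\<And>w. Re (cinner (C w) w) \<le> d * (norm (C w))\<^sup>2"
  shows "norm (C w) \<le> d * norm (C (C w))"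
proof -
  interpret C: bounded_linear C by (rule C)
  \<comment> \<open>Evaluating the form of C at this vector replaces its Cauchy-Schwarz inequality
    \<open>\<langle>C\<^sup>2w,w\<rangle>\<^sup>2 \<le> \<langle>Cw,w\<rangle>\<langle>C\<^sup>3w,w\<rangle>\<close>.\<close>
  have "0 \<le> Re (cinner (C (w - d *\<^sub>R C w)) (w - d *\<^sub>R C w))" by (rule nonneg)
  also have "\<dots> = Re (cinner (C w) w) - 2 * d * (norm (C w))\<^sup>2 + d\<^sup>2 * Re (cinner (C (C w)) (C w))"
    by (simp add: C.diff C.scaleR cinner_diff_left cinner_diff_right cinner.scaleR_left
        cinner.scaleR_right sym[of "C w" w]
        norm_sq_eq_cinner[of "C w", unfolded power2_eq_square] power2_eq_square algebra_simps)
  finally have "d * (norm (C w))\<^sup>2 \<le> d * (d * Re (cinner (C (C w)) (C w)))"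
    using d(2)[of w] by (simp add: power2_eq_square algebra_simps)
  then have "(norm (C w))\<^sup>2 \<le> d * Re (cinner (C (C w)) (C w))" using d(1) by simp
  also have "\<dots> \<le> d * (norm (C (C w)) * norm (C w))"
    using Re_cinner_le[of "C (C w)" "C w"] d(1) by (intro mult_left_mono) auto
  finally have "norm (C w) * norm (C w) \<le> (d * norm (C (C w))) * norm (C w)"
    by (simp add: power2_eq_square)
  then show ?thesis using d(1) by (cases "C w = 0") auto
qed

text \<open>Applying the bounded inverse to the convergent differences recovers \<open>x n\<close>,
  so the whole sequence converges.\<close>

lemma resolvent_set_semi_fredholm:
  assumes T: "lin_rel T" and l: "l \<in> rel_resolvent_set T"
  shows "semi_fredholm T l"
  unfolding semi_fredholm_def
proof (intro allI impI)
  fix x f :: "nat \<Rightarrow> 'a"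
  assume xf: "\<forall>n. (x n, f n) \<in> T" and "convergent (\<lambda>n. f n - l *\<^sub>C x n)"
  then obtain b where b: "(\<lambda>n. f n - l *\<^sub>C x n) \<longlonglongrightarrow> b" by (auto simp: convergent_def)
  obtain B where B: "bounded_linear B" "\<And>x f. (x, f) \<in> T \<Longrightarrow> B (l *\<^sub>C x - f) = x"
    by (rule resolvent_set_obtain[OF T l]) blast
  have "(\<lambda>n. B (- (f n - l *\<^sub>C x n))) \<longlonglongrightarrow> B (- b)"
    by (intro bounded_linear.tendsto[OF B(1)] tendsto_minus b)
  then have "x \<longlonglongrightarrow> B (- b)" using B(2)[OF xf[rule_format]] by simp
  then show "\<exists>r. strict_mono (r::nat \<Rightarrow> nat) \<and> convergent (x \<circ> r)"
    by (intro exI[of _ id]) (auto simp: strict_mono_def convergent_def)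
qed

text \<open>Each \<open>x n\<close> splits into a part in the closed range of \<open>C\<close>,
  where \<open>C\<close> is bounded below and the parts converge, and a part in the kernel of
  \<open>C\<close>, contained in the finite-dimensional eigenspace.\<close>

lemma isolated_finite_multiplicity_semi_fredholm:
  assumes T: "lin_rel T" "selfadjoint T" and e: "e > 0"
    and res: "\<And>t. t \<noteq> 0 \<Longrightarrow> \<bar>t\<bar> < e \<Longrightarrow> complex_of_real (a + t) \<in> rel_resolvent_set T"
    and fin: "\<not> infinite_dim (eigenspace T (complex_of_real a))"
  shows "semi_fredholm T (complex_of_real a)"
proof -
  let ?l = "complex_of_real a"
  define t where "t = e / 2"
  have t: "t > 0" using e by (simp add: t_def)
  define m where "m = complex_of_real (a + t)"
  have m: "m *\<^sub>C x = ?l *\<^sub>C x + t *\<^sub>R x" for x :: 'a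
    by (simp add: m_def scaleC_add_left scaleR_scaleC)
  have "m \<in> rel_resolvent_set T" unfolding m_def by (rule res) (use e in \<open>auto simp: t_def\<close>)
  then obtain B where B: "bounded_linear B" "\<And>w. (B w, m *\<^sub>C B w - w) \<in> T"
    "\<And>x f. (x, f) \<in> T \<Longrightarrow> B (m *\<^sub>C x - f) = x"
    by (rule resolvent_set_obtain[OF T(1)]) blast
  interpret B: bounded_linear B by (rule B(1))
  have symB: "cinner (B w) v = cinner w (B v)" for w v
    by (rule resolvent_symmetric[OF selfadjoint_imp_hermitian[OF T(2)] _ B(2)]) (simp add: m_def)
  \<comment> \<open>Complex homogeneity is what makes the range of \<open>C\<close> a complex
    subspace, as the projection requires.\<close>
  have scB: "B (c *\<^sub>C w) = c *\<^sub>C B w" for c w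
    using B(3)[OF lin_rel_scaleC[OF T(1) B(2)[of w], of c]]
    by (simp add: scaleC.diff_right mult.commute)
  \<comment> \<open>Since \<open>m = a + t\<close> and \<open>B\<close> inverts
    \<open>m - T\<close>, this is \<open>(T - a)(T - m)\<^sup>-\<^sup>1\<close> without mention of
    \<open>T\<close>.\<close>
  define C where "C = (\<lambda>w. w - t *\<^sub>R B w)"
  have C: "bounded_linear C"
    unfolding C_def
    by (intro bounded_linear_sub bounded_linear_ident bounded_linear_scaleR_right
        bounded_linear_compose[OF bounded_linear_scaleR_right B(1)])
  interpret C: bounded_linear C by (rule C)
  have symC: "cinner (C w) v = cinner w (C v)" for w v
    by (simp add: C_def cinner_diff_left cinner_diff_right cinner.scaleR_left cinner.scaleR_right symB)
  \<comment> \<open>The form bound applied to \<open>B w\<close> with defect \<open>- C w\<close>,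
    where \<open>e = 2 * t\<close> and \<open>t *\<^sub>R B w = w - C w\<close>. It traps the form
    of \<open>C\<close> between 1/2 and 3/2 times \<open>(norm (C w))\<^sup>2\<close>.\<close>
  have form: "2 * \<bar>Re (cinner (C w) w) - (norm (C w))\<^sup>2\<bar> \<le> (norm (C w))\<^sup>2" for w
  proof -
    have k: "(m *\<^sub>C B w - w) - ?l *\<^sub>C B w = - C w" by (simp add: m C_def)
    have le: "e * \<bar>Re (cinner (C w) (B w))\<bar> \<le> (norm (C w))\<^sup>2"
      using selfadjoint_isolated_form_bound[OF T e res B(2), of w]
      unfolding k by (simp add: cinner_minus_left)
    have eq: "Re (cinner (C w) w) - (norm (C w))\<^sup>2 = t * Re (cinner (C w) (B w))"
    proof -
      have "Re (cinner (C w) (w - C w)) = t * Re (cinner (C w) (B w))"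
        by (simp add: C_def cinner.scaleR_right)
      then show ?thesis by (simp add: cinner_diff_right norm_sq_eq_cinner)
    qed
    show ?thesis unfolding eq using le e by (simp add: t_def abs_mult)
  qed
  have "norm (C w) \<le> 3/2 * norm (C (C w))" for w
  proof (rule symmetric_range_bounded_below[OF C symC])
    show "0 \<le> Re (cinner (C w) w)" for w
      using form[of w] abs_ge_minus_self[of "Re (cinner (C w) w) - (norm (C w))\<^sup>2"]
        zero_le_power2[of "norm (C w)"] by argo
    show "Re (cinner (C w) w) \<le> 3/2 * (norm (C w))\<^sup>2" for w
      using form[of w] abs_ge_self[of "Re (cinner (C w) w) - (norm (C w))\<^sup>2"] by argo
  qed simp
  \<comment> \<open>The inequality is a closed condition, so it passes from the range to its
    closure.\<close>
  then have "range C \<subseteq> {y. norm y \<le> 3/2 * norm (C y)}" by auto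
  moreover have "closed {y. norm y \<le> 3/2 * norm (C y)}"
    by (intro closed_Collect_le continuous_intros linear_continuous_on C)
  ultimately have below: "norm y \<le> 3/2 * norm (C y)" if "y \<in> closure (range C)" for y
    using closure_minimal that by blast
  have sub: "cvs.subspace (closure (range C))"
  proof (rule subspace_closure)
    have "c *\<^sub>C C w = C (c *\<^sub>C w)" for c w
      by (simp add: C_def scB scaleC.diff_right scaleC.scaleR_right)
    then show "cvs.subspace (range C)"
      unfolding cvs.subspace_def by (auto simp: C.add[symmetric] image_iff intro: exI[of _ 0])
  qed
  show ?thesis
    unfolding semi_fredholm_def
  proof (intro allI impI)
    fix x f :: "nat \<Rightarrow> 'a"
    assume xf: "\<forall>n. (x n, f n) \<in> T" and bx: "bounded (range x)"
      and "convergent (\<lambda>n. f n - ?l *\<^sub>C x n)"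
    then obtain b where b: "(\<lambda>n. f n - ?l *\<^sub>C x n) \<longlonglongrightarrow> b" by (auto simp: convergent_def)
    \<comment> \<open>Expresses \<open>C (x n)\<close> through the convergent differences alone;
      hence \<open>C (x n)\<close> converges.\<close>
    have Cx: "C (x n) = - B (f n - ?l *\<^sub>C x n)" for n
    proof -
      have "B (t *\<^sub>R x n - (f n - ?l *\<^sub>C x n)) = x n"
        using B(3)[OF xf[rule_format, of n]] by (simp add: m algebra_simps)
      then have eq: "t *\<^sub>R B (x n) - B (f n - ?l *\<^sub>C x n) = x n"
        by (subst (asm) B.diff) (subst (asm) B.scaleR)
      have "C (x n) = (t *\<^sub>R B (x n) - B (f n - ?l *\<^sub>C x n)) - t *\<^sub>R B (x n)"
        by (simp only: eq C_def)
      also have "\<dots> = - B (f n - ?l *\<^sub>C x n)"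
        by simp
      finally show ?thesis .
    qed
    have "(\<lambda>n. C (x n)) \<longlonglongrightarrow> - B b"
      unfolding Cx by (intro tendsto_minus B.tendsto b)
    then have cC: "Cauchy (\<lambda>n. C (x n))" using LIMSEQ_imp_Cauchy by blast
    have "\<exists>p. p \<in> closure (range C) \<and> (\<forall>q\<in>closure (range C). cinner (x n - p) q = 0)" for n
      using ex_orthogonal_projection[OF sub closed_closure] by metis
    then obtain p where p: "\<And>n. p n \<in> closure (range C)"
      "\<And>n q. q \<in> closure (range C) \<Longrightarrow> cinner (x n - p n) q = 0" by metis
    have Cq: "C (x n - p n) = 0" for n
    proof -
      have "C (C (x n - p n)) \<in> closure (range C)"
        by (rule closure_subset[THEN subsetD, OF rangeI])
      \<comment> \<open>By symmetry the complement of the range is the kernel: test orthogonality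
        against \<open>C\<close> applied twice.\<close>
      from p(2)[OF this, of n] have "cinner (C (x n - p n)) (C (x n - p n)) = 0"
        by (subst symC)
      then show ?thesis by (simp only: cinner_eq_zero_iff)
    qed
    have qN: "x n - p n \<in> eigenspace T ?l" for n
    proof -
      let ?q = "x n - p n"
      have q: "t *\<^sub>R B ?q = ?q" using Cq[of n] unfolding C_def by simp
      have "(t *\<^sub>R B ?q, t *\<^sub>R (m *\<^sub>C B ?q - ?q)) \<in> T"
        unfolding scaleR_scaleC by (rule lin_rel_scaleC[OF T(1) B(2)])
      moreover have "t *\<^sub>R (m *\<^sub>C B ?q - ?q) = m *\<^sub>C (t *\<^sub>R B ?q) - t *\<^sub>R ?q"
        by (simp only: scaleR_diff_right scaleC.scaleR_right)
      ultimately have "(?q, m *\<^sub>C ?q - t *\<^sub>R ?q) \<in> T" unfolding q by simp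
      then show ?thesis by (simp add: eigenspace_def m)
    qed
    have "Cauchy p"
    proof (rule CauchyI)
      fix d :: real assume d: "0 < d"
      obtain N where N: "\<And>i j. i \<ge> N \<Longrightarrow> j \<ge> N \<Longrightarrow> norm (C (x i) - C (x j)) < 2/3 * d"
        using CauchyD[OF cC, of "2/3 * d"] d by auto
      have "norm (p i - p j) < d" if "i \<ge> N" "j \<ge> N" for i j
      proof -
        have "C (p i - p j) = C (x i) - C (x j)"
          using Cq[of i] Cq[of j] by (simp add: C.diff)
        then show ?thesis
          using below[OF cvs.subspace_diff[OF sub p(1)[of i] p(1)[of j]]] N[OF that] by simp
      qed
      then show "\<exists>N. \<forall>i\<ge>N. \<forall>j\<ge>N. norm (p i - p j) < d" by blast
    qed
    then have cp: "convergent p" by (rule Cauchy_convergent)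
    then obtain p' where "p \<longlonglongrightarrow> p'" by (auto simp: convergent_def)
    then have "bounded (range (\<lambda>n. x n - p n))"
      by (intro bounded_minus_comp bx convergent_imp_bounded)
    then obtain r where r: "strict_mono (r::nat \<Rightarrow> nat)" "convergent ((\<lambda>n. x n - p n) \<circ> r)"
      using finite_dim_convergent_subsequence[of _ "\<lambda>n. x n - p n", OF subspace_eigenspace[OF T(1)] fin qN]
      by blast
    have "convergent (\<lambda>n. ((\<lambda>n. x n - p n) \<circ> r) n + (p \<circ> r) n)"
      by (intro convergent_add r convergent_subseq_convergent cp)
    then have "convergent (x \<circ> r)" by (simp add: o_def)
    then show "\<exists>r. strict_mono (r::nat \<Rightarrow> nat) \<and> convergent (x \<circ> r)" using r(1) by blast
  qed
qed

text \<open>Outside the resolvent set, \<open>l\<close> is real, isolated in the spectrum and of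
  finite multiplicity, which is the situation of the previous lemma.\<close>

lemma not_ess_spectrum_semi_fredholm:
  assumes T: "lin_rel T" "selfadjoint T" and l: "l \<notin> ess_spectrum T"
  shows "semi_fredholm T l"
proof (cases "l \<in> rel_resolvent_set T")
  case True
  then show ?thesis by (rule resolvent_set_semi_fredholm[OF T(1)])
next
  case False
  then have "Im l = 0" using selfadjoint_nonreal_resolvent[OF T] by blast
  then have la: "l = complex_of_real (Re l)" by (simp add: complex_eq_iff)
  have nl: "\<not> l islimpt rel_spectrum T" and ne: "\<not> (is_eigenvalue T l \<and> infinite_dim (eigenspace T l))"
    using l False by (auto simp: ess_spectrum_def rel_spectrum_def)
  have "is_eigenvalue T l" if inf: "infinite_dim (eigenspace T l)"
  proof -
    obtain F where "F \<subseteq> eigenspace T l" "finite F" "orthonormal F" "card F = 1"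
      using infinite_dim_orthonormal[OF subspace_eigenspace[OF T(1)] inf] by blast
    then obtain x where "x \<in> eigenspace T l" "norm x = 1"
      by (metis card_1_singletonE insert_subset orthonormal_def singletonI)
    then show ?thesis unfolding is_eigenvalue_def eigenspace_def by force
  qed
  then have fin: "\<not> infinite_dim (eigenspace T l)" using ne by blast
  obtain e where e: "e > 0" "\<And>z. z \<in> rel_spectrum T \<Longrightarrow> z \<noteq> l \<Longrightarrow> e \<le> dist z l"
    using nl unfolding islimpt_approachable by (meson not_le)
  have "complex_of_real (Re l + t) \<in> rel_resolvent_set T" if t: "t \<noteq> 0" "\<bar>t\<bar> < e" for t
  proof (rule ccontr)
    let ?z = "complex_of_real (Re l + t)"
    assume "?z \<notin> rel_resolvent_set T"
    moreover have "?z - l = complex_of_real t" using la by (metis add_diff_cancel_left' of_real_add)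
    ultimately show False
      using e(2)[of ?z] t by (auto simp: rel_spectrum_def dist_norm)
  qed
  then show ?thesis
    using isolated_finite_multiplicity_semi_fredholm[OF T e(1), of "Re l"] fin la by metis
qed

lemma ess_spectrum_iff_not_semi_fredholm:
  assumes "lin_rel T" "selfadjoint T"
  shows "l \<in> ess_spectrum T \<longleftrightarrow> \<not> semi_fredholm T l"
  using semi_fredholm_not_ess_spectrum[OF assms] not_ess_spectrum_semi_fredholm[OF assms] by blast

section \<open>Relatively compact perturbations\<close>

lemma op_part_iff:
  "(x, s) \<in> op_part T \<longleftrightarrow> (x, s) \<in> T \<and> (\<forall>g. (0, g) \<in> T \<longrightarrow> cinner s g = 0)"
  by (auto simp: op_part_def rel_inf_def pinner_def)

text \<open>Subtract from \<open>f\<close> its projection onto \<open>T(0)\<close>, which is closed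
  because \<open>T\<close> is.\<close>

lemma op_part_exists:
  assumes T: "lin_rel T" "closed T" and xf: "(x, f) \<in> T"
  obtains s where "(x, s) \<in> op_part T"
proof -
  let ?M = "{g. (0, g) \<in> T}"
  have "cvs.subspace ?M"
    using lin_rel_zero[OF T(1)] lin_rel_add[OF T(1), of 0 _ 0] lin_rel_scaleC[OF T(1), of 0]
    by (auto simp: cvs.subspace_def)
  moreover have "closed ?M"
    unfolding closed_sequential_limits using closed_relD[OF T(2) _ tendsto_const] by blast
  ultimately obtain p where p: "(0, p) \<in> T" "\<And>q. (0, q) \<in> T \<Longrightarrow> cinner (f - p) q = 0"
    using ex_orthogonal_projection[of ?M f] by auto
  have "(x, f - p) \<in> T" using lin_rel_diff[OF T(1) xf p(1)] by simp
  then show ?thesis using p(2) that[of "f - p"] by (simp add: op_part_iff)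
qed

text \<open>The operator part selects the element of least norm in \<open>T(x)\<close>:
  \<open>f - s\<close> lies in \<open>T(0)\<close>, to which \<open>s\<close> is orthogonal.\<close>

lemma op_part_norm_le:
  assumes T: "lin_rel T" and s: "(x, s) \<in> op_part T" and f: "(x, f) \<in> T"
  shows "norm s \<le> norm f"
proof -
  have "(0, f - s) \<in> T" using lin_rel_diff[OF T f, of x s] s by (simp add: op_part_iff)
  then have "cinner s (f - s) = 0" using s by (simp add: op_part_iff)
  then have "(norm f)\<^sup>2 = (norm s)\<^sup>2 + (norm (f - s))\<^sup>2" using norm_add_sq[of s "f - s"] by simp
  then have "(norm s)\<^sup>2 \<le> (norm f)\<^sup>2" by simp
  then show ?thesis by (rule power2_le_imp_le) simp
qed

lemma lin_rel_op_part:
  assumes T: "lin_rel T" shows "lin_rel (op_part T)"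
  unfolding lin_rel_def op_part_iff
  using lin_rel_zero[OF T] lin_rel_add[OF T] lin_rel_scaleC[OF T]
  by (auto simp: cinner_add_left cinner_scaleC_left)

lemma op_part_unique:
  assumes T: "lin_rel T" and s: "(x, s) \<in> op_part T" "(x, s') \<in> op_part T"
  shows "s = s'"
proof -
  have "(0, s - s') \<in> op_part T" using lin_rel_diff[OF lin_rel_op_part[OF T] s] by simp
  then have "cinner (s - s') (s - s') = 0" unfolding op_part_iff by blast
  then show ?thesis by simp
qed

text \<open>For \<open>(y, g)\<close> in the adjoint choose \<open>(x, h)\<close> in
  \<open>T\<close> with the same image under \<open>l - T\<close>. Then \<open>y - x\<close> is
  orthogonal to the range of \<open>cnj l - T\<close>, which is everything, so
  \<open>(y, g) = (x, h)\<close>.\<close>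

lemma hermitian_surj_selfadjoint:
  assumes T: "lin_rel T" "hermitian T"
    and sur: "\<And>z. \<exists>x h. (x, h) \<in> T \<and> l *\<^sub>C x - h = z"
    and sur': "\<And>z. \<exists>x h. (x, h) \<in> T \<and> cnj l *\<^sub>C x - h = z"
  shows "selfadjoint T"
proof -
  have "(y, g) \<in> T" if yg: "(y, g) \<in> radjoint T" for y g
  proof -
    obtain x h where xh: "(x, h) \<in> T" "l *\<^sub>C x - h = l *\<^sub>C y - g" using sur by blast
    define u where "u = y - x"
    have gh: "g - h = l *\<^sub>C u" using xh(2) by (simp add: u_def scaleC.diff_right algebra_simps)
    obtain x' f' where x': "(x', f') \<in> T" "cnj l *\<^sub>C x' - f' = u" using sur' by blast
    have "cinner (g - h) x' = cinner u f'"
      using yg x'(1) hermitianD[OF T(2) x'(1) xh(1)]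
      by (simp add: radjoint_def u_def cinner_diff_left)
    then have "cinner u (cnj l *\<^sub>C x' - f') = 0"
      unfolding gh by (simp add: cinner_diff_right cinner_scaleC_left cinner_scaleC_right)
    then have "u = 0" unfolding x'(2) by simp
    then show ?thesis using gh xh(1) by (simp add: u_def)
  qed
  then show ?thesis using T(2) by (auto simp: selfadjoint_def hermitian_def)
qed

section \<open>The perturbation as an operator and its relative bound\<close>

locale compact_perturbation =
  fixes S A :: "('a::chilbert \<times> 'a) set"
  assumes S: "lin_rel S" "selfadjoint S"
    and A: "lin_rel A" "closed A" "hermitian A"
    and dom: "rdom S \<subseteq> rdom A"
    and cpt: "rel_compact (op_part A) (op_part S)"
begin

text \<open>A function form of the operator part of \<open>A\<close>. It is unspecified off the
  domain of \<open>A\<close>, so its rules carry a membership hypothesis.\<close>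

definition opA :: "'a \<Rightarrow> 'a" where "opA x = (THE g. (x, g) \<in> op_part A)"

lemma opA_eq: "(x, g) \<in> op_part A \<Longrightarrow> opA x = g"
  unfolding opA_def by (rule the_equality) (auto dest: op_part_unique[OF A(1)])

lemma opA_mem:
  assumes "(x, f) \<in> S" shows "(x, opA x) \<in> op_part A"
proof -
  obtain g where "(x, g) \<in> A" using assms dom by (auto simp: rdom_def)
  then obtain s where "(x, s) \<in> op_part A" by (rule op_part_exists[OF A(1,2)])
  then show ?thesis using opA_eq by simp
qed

lemma opA_diff: "(x, f) \<in> S \<Longrightarrow> (y, g) \<in> S \<Longrightarrow> opA (x - y) = opA x - opA y"
  by (rule opA_eq[OF lin_rel_diff[OF lin_rel_op_part[OF A(1)] opA_mem opA_mem]])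

lemma opA_scaleC: "(x, f) \<in> S \<Longrightarrow> opA (c *\<^sub>C x) = c *\<^sub>C opA x"
  by (rule opA_eq[OF lin_rel_scaleC[OF lin_rel_op_part[OF A(1)] opA_mem]])

text \<open>\<open>A(0)\<close> is orthogonal to \<open>D(A) \<supseteq> D(S)\<close>, and the orthogonal complement of \<open>D(S)\<close> is \<open>S(0)\<close>.\<close>

lemma mul_A_subset_mul_S:
  assumes "(0, g) \<in> A" shows "(0, g) \<in> S"
proof (rule selfadjoint_memI[OF S(2)])
  fix x f assume "(x, f) \<in> S"
  then obtain h where "(x, h) \<in> A" using dom by (auto simp: rdom_def)
  then show "cinner g x = cinner 0 f" using hermitianD[OF A(3) _ assms] by simp
qed

text \<open>\<open>A(x)\<close> is \<open>opA x\<close> plus \<open>A(0)\<close>, and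
  \<open>A(0)\<close> is absorbed by \<open>S(0)\<close>. From here on the sum is treated as
  \<open>S\<close> plus the operator \<open>opA\<close>.\<close>

lemma relation_sum_iff: "(x, h) \<in> relation_sum S A \<longleftrightarrow> (x, h - opA x) \<in> S"
proof
  assume "(x, h) \<in> relation_sum S A"
  then obtain f g where fg: "(x, f) \<in> S" "(x, g) \<in> A" "h = f + g" by (auto simp: relation_sum_def)
  have "(x, opA x) \<in> A" using opA_mem[OF fg(1)] by (simp add: op_part_iff)
  then have "(0, g - opA x) \<in> S"
    using lin_rel_diff[OF A(1) fg(2), of x "opA x"] by (intro mul_A_subset_mul_S) simp
  then show "(x, h - opA x) \<in> S"
    using lin_rel_add[OF S(1) fg(1), of 0 "g - opA x"] by (simp add: fg(3) algebra_simps)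
next
  assume a: "(x, h - opA x) \<in> S"
  then have "(x, opA x) \<in> A" using opA_mem by (simp add: op_part_iff)
  then show "(x, h) \<in> relation_sum S A"
    unfolding relation_sum_def mem_Collect_eq using a
    by (intro exI[of _ x] exI[of _ "h - opA x"] exI[of _ "opA x"]) simp
qed

lemma opA_convergent_subsequence:
  assumes xs: "\<And>n. (x n, s n) \<in> op_part S" and b: "bounded (range x)" "bounded (range s)"
  obtains r g where "strict_mono (r::nat \<Rightarrow> nat)" "(\<lambda>n. opA (x (r n))) \<longlonglongrightarrow> g"
proof -
  obtain K L where KL: "\<And>n. norm (x n) \<le> K" "\<And>n. norm (s n) \<le> L"
    using b by (auto simp: bounded_iff)
  let ?B = "range (\<lambda>n. (x n, s n))"
  let ?G = "{g. \<exists>x f. (x, f) \<in> ?B \<and> (x, g) \<in> op_part A}"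
  have "?B \<subseteq> op_part S" "\<forall>(x, f)\<in>?B. norm x + norm f \<le> K + L"
    using xs KL by (auto intro: add_mono)
  then have "compact (closure ?G)" using cpt unfolding rel_compact_def by blast
  moreover have "opA (x n) \<in> closure ?G" for n
  proof -
    have "(x n, opA (x n)) \<in> op_part A"
      using xs[of n] by (intro opA_mem[of _ "s n"]) (simp add: op_part_iff)
    then show ?thesis by (intro closure_subset[THEN subsetD]) blast
  qed
  ultimately obtain g r where "strict_mono (r::nat \<Rightarrow> nat)" "((\<lambda>n. opA (x n)) \<circ> r) \<longlonglongrightarrow> g"
    unfolding compact_def by meson
  then show ?thesis using that by (simp add: o_def)
qed

text \<open>Failure for every \<open>K\<close> gives \<open>opA (x n)\<close> of norm 1 with
  \<open>x n\<close> tending to 0 and \<open>s n\<close> bounded. By compactness a subsequence of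
  \<open>opA (x n)\<close> has a limit \<open>g\<close>, which closedness puts into
  \<open>A(0)\<close>; as the values are orthogonal to \<open>A(0)\<close>, \<open>g\<close> is
  0.\<close>

lemma opA_relative_bound:
  "\<exists>K\<ge>0. \<forall>x s. (x, s) \<in> op_part S \<longrightarrow> norm (opA x) \<le> 1/2 * norm s + K * norm x"
proof (rule ccontr)
  assume no: "\<not> ?thesis"
  have "\<exists>x s. (x, s) \<in> op_part S \<and> norm (opA x) = 1 \<and> norm s \<le> 2 \<and> norm x \<le> inverse (real (Suc n))" for n
  proof -
    have "\<not> (\<forall>x s. (x, s) \<in> op_part S \<longrightarrow> norm (opA x) \<le> 1/2 * norm s + real (Suc n) * norm x)"
      using no of_nat_0_le_iff by blast
    then obtain x s where xs: "(x, s) \<in> op_part S"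
      and gt: "1/2 * norm s + real (Suc n) * norm x < norm (opA x)" by (meson not_le)
    have "0 \<le> 1/2 * norm s + real (Suc n) * norm x" by simp
    then have pos: "norm (opA x) > 0" using gt by linarith
    define c where "c = complex_of_real (1 / norm (opA x))"
    have nc: "norm (c *\<^sub>C y) = norm y / norm (opA x)" for y :: 'a
      unfolding c_def norm_scaleC norm_of_real by simp
    have xS: "(x, s) \<in> S" using xs by (simp add: op_part_iff)
    have "(c *\<^sub>C x, c *\<^sub>C s) \<in> op_part S" by (intro lin_rel_scaleC lin_rel_op_part S xs)
    moreover have "norm (opA (c *\<^sub>C x)) = 1" unfolding opA_scaleC[OF xS] nc using pos by simp
    moreover have "norm (c *\<^sub>C s) \<le> 2"
    proof -
      have "0 \<le> real (Suc n) * norm x" by simp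
      then have "norm s \<le> 2 * norm (opA x)" using gt by linarith
      then show ?thesis unfolding nc using pos by (simp add: divide_le_eq)
    qed
    moreover have "norm (c *\<^sub>C x) \<le> inverse (real (Suc n))"
    proof -
      have "real (Suc n) * norm x \<le> norm (opA x)" using gt norm_ge_zero[of s] by linarith
      then show ?thesis unfolding nc using pos by (simp add: field_simps)
    qed
    ultimately show ?thesis by blast
  qed
  then obtain x s where xs: "\<And>n. (x n, s n) \<in> op_part S" "\<And>n. norm (opA (x n)) = 1"
    "\<And>n. norm (s n) \<le> 2" "\<And>n. norm (x n) \<le> inverse (real (Suc n))" by metis
  have x0: "x \<longlonglongrightarrow> 0"
    using LIMSEQ_inverse_real_of_nat xs(4)
    by (auto intro!: Lim_null_comparison[of _ "\<lambda>n. inverse (real (Suc n))"] always_eventually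
        simp del: of_nat_Suc)
  then have "bounded (range x)" by (intro convergent_imp_bounded)
  moreover have "bounded (range s)" using xs(3) by (auto simp: bounded_iff)
  ultimately obtain r g where r: "strict_mono (r::nat \<Rightarrow> nat)" "(\<lambda>n. opA (x (r n))) \<longlonglongrightarrow> g"
    using opA_convergent_subsequence[of x s, OF xs(1)] by blast
  have mem: "(x n, opA (x n)) \<in> op_part A" for n
    using xs(1)[of n] by (intro opA_mem[of _ "s n"]) (simp add: op_part_iff)
  have "(0, g) \<in> A"
  proof (rule closed_relD[OF A(2) _ _ r(2)])
    show "(x (r n), opA (x (r n))) \<in> A" for n using mem by (simp add: op_part_iff)
    show "(\<lambda>n. x (r n)) \<longlonglongrightarrow> 0" using LIMSEQ_subseq_LIMSEQ[OF x0 r(1)] by (simp add: o_def)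
  qed
  then have "cinner (opA (x (r n))) g = 0" for n using mem by (simp add: op_part_iff)
  moreover have "(\<lambda>n. cinner (opA (x (r n))) g) \<longlonglongrightarrow> cinner g g"
    by (intro cinner.tendsto r tendsto_const)
  ultimately have "g = 0" by (simp add: LIMSEQ_const_iff)
  moreover have "norm g = 1" using tendsto_norm[OF r(2)] xs(2) by (simp add: LIMSEQ_const_iff)
  ultimately show False by simp
qed

section \<open>Self-adjointness of the sum\<close>

lemma lin_rel_relation_sum: "lin_rel (relation_sum S A)"
  unfolding lin_rel_def
proof (intro conjI allI impI)
  show "(0, 0) \<in> relation_sum S A"
    using lin_rel_zero[OF S(1)] lin_rel_zero[OF A(1)] by (force simp: relation_sum_def)
next
  fix x f y g assume "(x, f) \<in> relation_sum S A" "(y, g) \<in> relation_sum S A"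
  then obtain f1 f2 g1 g2 where "(x, f1) \<in> S" "(x, f2) \<in> A" "f = f1 + f2"
    "(y, g1) \<in> S" "(y, g2) \<in> A" "g = g1 + g2" by (auto simp: relation_sum_def)
  then have "(x + y, f1 + g1) \<in> S" "(x + y, f2 + g2) \<in> A" "f + g = (f1 + g1) + (f2 + g2)"
    by (simp_all add: lin_rel_add S(1) A(1))
  then show "(x + y, f + g) \<in> relation_sum S A" unfolding relation_sum_def by blast
next
  fix c x f assume "(x, f) \<in> relation_sum S A"
  then obtain f1 f2 where "(x, f1) \<in> S" "(x, f2) \<in> A" "f = f1 + f2"
    by (auto simp: relation_sum_def)
  then have "(c *\<^sub>C x, c *\<^sub>C f1) \<in> S" "(c *\<^sub>C x, c *\<^sub>C f2) \<in> A"
    "c *\<^sub>C f = c *\<^sub>C f1 + c *\<^sub>C f2"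
    by (simp_all add: lin_rel_scaleC S(1) A(1) scaleC_add_right)
  then show "(c *\<^sub>C x, c *\<^sub>C f) \<in> relation_sum S A" unfolding relation_sum_def by blast
qed

lemma hermitian_relation_sum: "hermitian (relation_sum S A)"
proof -
  have "cinner h x = cinner y k"
    if xk: "(x, k) \<in> relation_sum S A" and yh: "(y, h) \<in> relation_sum S A" for x k y h
  proof -
    obtain f g where fg: "(x, f) \<in> S" "(x, g) \<in> A" "k = f + g"
      using xk by (auto simp: relation_sum_def)
    obtain f' g' where fg': "(y, f') \<in> S" "(y, g') \<in> A" "h = f' + g'"
      using yh by (auto simp: relation_sum_def)
    show ?thesis
      unfolding fg(3) fg'(3) cinner_add_left cinner_add_right
      using hermitianD[OF selfadjoint_imp_hermitian[OF S(2)] fg(1) fg'(1)]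
        hermitianD[OF A(3) fg(2) fg'(2)] by simp
  qed
  then show ?thesis by (auto simp: hermitian_def radjoint_def)
qed

text \<open>The Kato-Rellich argument: with \<open>B\<close> the resolvent of \<open>S\<close> at
  \<open>l\<close>, the solution is \<open>x = B w\<close> for the fixed point \<open>w\<close> of
  \<open>z + opA (B w)\<close>, a contraction for \<open>l\<close> far up or down the imaginary
  axis.\<close>

lemma relation_sum_surj:
  assumes K: "K \<ge> 0" "\<And>x s. (x, s) \<in> op_part S \<Longrightarrow> norm (opA x) \<le> 1/2 * norm s + K * norm x"
    and l: "Re l = 0" "\<bar>Im l\<bar> = 4 * K + 1"
  shows "\<exists>x h. (x, h) \<in> relation_sum S A \<and> l *\<^sub>C x - h = z"
proof -
  have "l \<in> rel_resolvent_set S"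
    using l(2) K(1) by (intro selfadjoint_nonreal_resolvent S) auto
  then obtain B where B: "bounded_linear B" "\<And>w. (B w, l *\<^sub>C B w - w) \<in> S"
    by (rule resolvent_set_obtain[OF S(1)]) blast
  interpret B: bounded_linear B by (rule B(1))
  note her = selfadjoint_imp_hermitian[OF S(2)]
  \<comment> \<open>The factor 3/4 is 1/2 from the relative bound plus 1/4 from
    \<open>K * norm x\<close>; the latter explains \<open>4 * K\<close> in the size of
    \<open>l\<close>, while the added 1 keeps \<open>l\<close> nonreal when
    \<open>K = 0\<close>.\<close>
  have bd: "norm (opA (B w)) \<le> 3/4 * norm w" for w
  proof -
    define x f where "x = B w" and "f = l *\<^sub>C x - w"
    have xf: "(x, f) \<in> S" using B(2) by (simp add: x_def f_def)
    obtain s where s: "(x, s) \<in> op_part S"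
      using op_part_exists[OF S(1) selfadjoint_imp_closed[OF S(2)] xf] by blast
    have "Im (cinner x f) = 0"
      using hermitian_Im_zero[OF her xf] hermitianD[OF her xf xf] by simp
    then have "Re (cinner (l *\<^sub>C x) f) = 0" using l(1) by (simp add: cinner_scaleC_left)
    \<comment> \<open>For purely imaginary \<open>l\<close>, \<open>l *\<^sub>C x\<close> and
      \<open>f\<close> are orthogonal for the real inner product, so \<open>norm w\<close> dominates
      both.\<close>
    then have "(norm w)\<^sup>2 = (norm (l *\<^sub>C x))\<^sup>2 + (norm f)\<^sup>2"
      using norm_diff_sq[of "l *\<^sub>C x" f] by (simp add: f_def)
    then have "(norm (l *\<^sub>C x))\<^sup>2 \<le> (norm w)\<^sup>2" "(norm f)\<^sup>2 \<le> (norm w)\<^sup>2" by simp_all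
    then have "norm (l *\<^sub>C x) \<le> norm w" and fw: "norm f \<le> norm w"
      by (auto dest: power2_le_imp_le)
    moreover have "cmod l = 4 * K + 1" using l by (simp add: cmod_eq_Im)
    ultimately have "(4 * K + 1) * norm x \<le> norm w" by (simp add: norm_scaleC)
    then have "4 * (K * norm x) + norm x \<le> norm w" by (simp add: algebra_simps)
    then have "K * norm x \<le> 1/4 * norm w" using norm_ge_zero[of x] by linarith
    moreover have "norm s \<le> norm w" using op_part_norm_le[OF S(1) s xf] fw by simp
    ultimately show ?thesis using K(2)[OF s] by (simp add: x_def)
  qed
  have "dist (z + opA (B v)) (z + opA (B w)) \<le> 3/4 * dist v w" for v w
    using bd[of "v - w"] opA_diff[OF B(2) B(2)] by (simp add: dist_norm B.diff)
  then have "\<exists>!w. z + opA (B w) = w" by (intro banach_fix_type[of "3/4"]) auto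
  then obtain w where w: "z + opA (B w) = w" by blast
  have "(B w, (l *\<^sub>C B w - w) + opA (B w)) \<in> relation_sum S A"
    using B(2) by (simp add: relation_sum_iff)
  moreover have "l *\<^sub>C B w - ((l *\<^sub>C B w - w) + opA (B w)) = z" using w by (simp add: algebra_simps)
  ultimately show ?thesis by blast
qed

text \<open>The surjectivity lemma depends on \<open>l\<close> only through \<open>Re l = 0\<close>
  and \<open>\<bar>Im l\<bar>\<close>, so it serves both \<open>l\<close> and
  \<open>cnj l\<close>.\<close>

lemma selfadjoint_relation_sum: "selfadjoint (relation_sum S A)"
proof -
  obtain K where K: "K \<ge> 0"
    "\<And>x s. (x, s) \<in> op_part S \<Longrightarrow> norm (opA x) \<le> 1/2 * norm s + K * norm x"
    using opA_relative_bound by metis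
  show ?thesis
    by (rule hermitian_surj_selfadjoint[OF lin_rel_relation_sum hermitian_relation_sum,
          of "Complex 0 (4 * K + 1)"])
      (rule relation_sum_surj[OF K]; use K(1) in simp)+
qed

section \<open>Invariance of the semi-Fredholm points\<close>

lemma semi_fredholm_relation_sum_iff: "semi_fredholm (relation_sum S A) l \<longleftrightarrow> semi_fredholm S l"
proof (rule iffI)
  assume F: "semi_fredholm S l"
  obtain K where K: "K \<ge> 0"
    "\<And>x s. (x, s) \<in> op_part S \<Longrightarrow> norm (opA x) \<le> 1/2 * norm s + K * norm x"
    using opA_relative_bound by metis
  show "semi_fredholm (relation_sum S A) l"
    unfolding semi_fredholm_def
  proof (intro allI impI)
    fix x h :: "nat \<Rightarrow> 'a"
    assume xh: "\<forall>n. (x n, h n) \<in> relation_sum S A" and bx: "bounded (range x)"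
      and cv: "convergent (\<lambda>n. h n - l *\<^sub>C x n)"
    define f where "f = (\<lambda>n. h n - opA (x n))"
    have xf: "(x n, f n) \<in> S" for n using xh by (simp add: relation_sum_iff f_def)
    have "\<exists>s. (x n, s) \<in> op_part S" for n
      by (rule op_part_exists[OF S(1) selfadjoint_imp_closed[OF S(2)] xf[of n]]) blast
    then obtain s where s: "\<And>n. (x n, s n) \<in> op_part S" by metis
    obtain M where M: "\<And>n. norm (x n) \<le> M" using bx by (auto simp: bounded_iff)
    obtain b where b: "(\<lambda>n. h n - l *\<^sub>C x n) \<longlonglongrightarrow> b" using cv by (auto simp: convergent_def)
    obtain M' where M': "\<And>n. norm (h n - l *\<^sub>C x n) \<le> M'"
      using convergent_imp_bounded[OF b] by (auto simp: bounded_iff)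
    have "norm (s n) \<le> 2 * (M' + cmod l * M + K * M)" for n
    proof -
      have "norm (s n) \<le> norm (f n)" by (rule op_part_norm_le[OF S(1) s xf])
      also have "\<dots> \<le> norm (h n) + norm (opA (x n))" unfolding f_def by (rule norm_triangle_ineq4)
      also have "norm (h n) \<le> norm (h n - l *\<^sub>C x n) + cmod l * norm (x n)"
        using norm_triangle_ineq[of "h n - l *\<^sub>C x n" "l *\<^sub>C x n"] by (simp add: norm_scaleC)
      \<comment> \<open>The relative bound reintroduces \<open>1/2 * norm (s n)\<close>, which moves
        to the left; this is where the factor 2 in the bound comes from.\<close>
      finally have "norm (s n) \<le> M' + cmod l * M + (1/2 * norm (s n) + K * M)"
        using K(2)[OF s, of n] M'[of n] mult_left_mono[OF M[of n], of "cmod l"]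
          mult_left_mono[OF M[of n] K(1)] norm_ge_zero[of l] by linarith
      then show ?thesis by simp
    qed
    then have "bounded (range s)" by (auto simp: bounded_iff)
    then obtain r g where r: "strict_mono (r::nat \<Rightarrow> nat)" "(\<lambda>n. opA (x (r n))) \<longlonglongrightarrow> g"
      using opA_convergent_subsequence[of x s, OF s bx] by blast
    have "(\<lambda>n. (h (r n) - l *\<^sub>C x (r n)) - opA (x (r n))) \<longlonglongrightarrow> b - g"
      using LIMSEQ_subseq_LIMSEQ[OF b r(1)] by (intro tendsto_diff r) (simp add: o_def)
    then have c: "convergent (\<lambda>n. f (r n) - l *\<^sub>C x (r n))"
      by (auto simp: convergent_def f_def algebra_simps)
    have "bounded (range (\<lambda>n. x (r n)))" by (rule bounded_subset[OF bx]) auto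
    then obtain q a where q: "strict_mono (q::nat \<Rightarrow> nat)" "((\<lambda>n. x (r n)) \<circ> q) \<longlonglongrightarrow> a"
      using semi_fredholmD[OF F xf _ c] by blast
    then show "\<exists>r. strict_mono (r::nat \<Rightarrow> nat) \<and> convergent (x \<circ> r)"
      using strict_mono_o[OF r(1) q(1)] by (auto simp: convergent_def o_def)
  qed
next
  assume F: "semi_fredholm (relation_sum S A) l"
  show "semi_fredholm S l"
    unfolding semi_fredholm_def
  proof (intro allI impI)
    fix x f :: "nat \<Rightarrow> 'a"
    assume xf: "\<forall>n. (x n, f n) \<in> S" and bx: "bounded (range x)"
      and cv: "convergent (\<lambda>n. f n - l *\<^sub>C x n)"
    have "\<exists>s. (x n, s) \<in> op_part S" for n
      by (rule op_part_exists[OF S(1) selfadjoint_imp_closed[OF S(2)] xf[rule_format, of n]]) blast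
    then obtain s where s: "\<And>n. (x n, s n) \<in> op_part S" by metis
    obtain M where M: "\<And>n. norm (x n) \<le> M" using bx by (auto simp: bounded_iff)
    obtain b where b: "(\<lambda>n. f n - l *\<^sub>C x n) \<longlonglongrightarrow> b" using cv by (auto simp: convergent_def)
    obtain M' where M': "\<And>n. norm (f n - l *\<^sub>C x n) \<le> M'"
      using convergent_imp_bounded[OF b] by (auto simp: bounded_iff)
    \<comment> \<open>In this direction the differences already control \<open>f n\<close>, hence
      also its operator part, without any absorption.\<close>
    have "norm (s n) \<le> M' + cmod l * M" for n
    proof -
      have "norm (s n) \<le> norm (f n)" by (rule op_part_norm_le[OF S(1) s xf[rule_format]])
      also have "\<dots> \<le> norm (f n - l *\<^sub>C x n) + cmod l * norm (x n)"
        using norm_triangle_ineq[of "f n - l *\<^sub>C x n" "l *\<^sub>C x n"] by (simp add: norm_scaleC)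
      finally show ?thesis
        using M'[of n] mult_left_mono[OF M[of n], of "cmod l"] by simp
    qed
    then have "bounded (range s)" by (auto simp: bounded_iff)
    then obtain r g where r: "strict_mono (r::nat \<Rightarrow> nat)" "(\<lambda>n. opA (x (r n))) \<longlonglongrightarrow> g"
      using opA_convergent_subsequence[of x s, OF s bx] by blast
    define h where "h = (\<lambda>n. f n + opA (x n))"
    have xh: "(x n, h n) \<in> relation_sum S A" for n using xf by (simp add: relation_sum_iff h_def)
    have "(\<lambda>n. (f (r n) - l *\<^sub>C x (r n)) + opA (x (r n))) \<longlonglongrightarrow> b + g"
      using LIMSEQ_subseq_LIMSEQ[OF b r(1)] by (intro tendsto_add r) (simp add: o_def)
    then have c: "convergent (\<lambda>n. h (r n) - l *\<^sub>C x (r n))"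
      by (auto simp: convergent_def h_def algebra_simps)
    have "bounded (range (\<lambda>n. x (r n)))" by (rule bounded_subset[OF bx]) auto
    then obtain q a where q: "strict_mono (q::nat \<Rightarrow> nat)" "((\<lambda>n. x (r n)) \<circ> q) \<longlonglongrightarrow> a"
      using semi_fredholmD[OF F xh _ c] by blast
    then show "\<exists>r. strict_mono (r::nat \<Rightarrow> nat) \<and> convergent (x \<circ> r)"
      using strict_mono_o[OF r(1) q(1)] by (auto simp: convergent_def o_def)
  qed
qed

end

theorem theorem5p2:
  fixes S A :: "('a::chilbert \<times> 'a) set"
  assumes "lin_rel S" and "selfadjoint S"
    and "lin_rel A" and "closed A" and "hermitian A"
    and "rdom S \<subseteq> rdom A"
    and "rel_compact (op_part A) (op_part S)"
  shows "ess_spectrum S = ess_spectrum (relation_sum S A)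
         \<and> (ess_spectrum S = {} \<longleftrightarrow> ess_spectrum (relation_sum S A) = {})"
proof -
  interpret compact_perturbation S A by unfold_locales (rule assms)+
  have "ess_spectrum S = ess_spectrum (relation_sum S A)"
    using ess_spectrum_iff_not_semi_fredholm[OF S]
      ess_spectrum_iff_not_semi_fredholm[OF lin_rel_relation_sum selfadjoint_relation_sum]
      semi_fredholm_relation_sum_iff by blast
  then show ?thesis by simp
qed

end
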